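(* There exists a universal constant $\kappa\in(0,\infty)$ with the following property. Let $m,n\in\mathbb{N}$ and $\phi,\theta\in(0,1/2)$, and suppose that there exists a $3$-query locally decodable code $C:\{-1,1\}^m\to\{-1,1\}^n$ of quality $(\phi,\theta)$. Then for every $K\in[1,\infty)$, every $K$-tensor-symmetric norm $\|\cdot\|$ on $\mathbb{R}^{3n}\otimes\mathbb{R}^{3n}\otimes\mathbb{R}^{3n}$ and every $q\in[2,\infty)$, $$K^2\,C_{\|\cdot\|}^{(q)}\cdot\frac{\left\|\sum_{i=1}^{3n}\sum_{j=1}^{3n}\sum_{k=1}^{3n}e_i\otimes e_j\otimes e_k\right\|}{\left\|\sum_{i=1}^{3n}e_i\otimes e_i\otimes e_i\right\|}\ge\kappa\,\frac{\phi\,\theta^2\,m^{1/q}}{\log(n+1)}.$$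
   Context: $\log$ is the natural logarithm; $e_1,\dots,e_N$ is the standard basis of $\mathbb{R}^N$; $S_N$ is the group of permutations of $\{1,\dots,N\}$. Locally decodable code: for $m,n\in\mathbb{N}$ and $\phi,\theta\in(0,1/2)$, a function $C:\{-1,1\}^m\to\{-1,1\}^n$ is a $3$-query locally decodable code of quality $(\phi,\theta)$ if for every $t\in\{1,\dots,m\}$ there is a probability distribution $\mathcal{A}_t$ over $4$-tuples $(i,j,k,g)$, where $i,j,k\in\{1,\dots,n\}$ and $g:\{-1,1\}^3\to\{-1,1\}$, such that for every $\varepsilon\in\{-1,1\}^m$ and every $\delta\in\{-1,1\}^n$ that differs from $C(\varepsilon)$ in at most $\phi n$ coordinates, with probability (with respect to $\mathcal{A}_t$) at least $\frac12+\theta$ one has $g(\delta_i,\delta_j,\delta_k)=\varepsilon_t$. Tensor-symmetric norm: for $K\in[1,\infty)$, a norm $\|\cdot\|$ on $\mathbb{R}^N\otimes\mathbb{R}^N\otimes\mathbb{R}^N$ is $K$-tensor-symmetric if for all $\pi,\sigma,\tau\in S_N$, all $\varepsilon,\delta,\eta\in\{-1,1\}^N$ and all scalars $\{a_{i,j,k}\}_{i,j,k=1}^N\subseteq\mathbb{R}$, $$\left\|\sum_{i,j,k=1}^N\varepsilon_i\delta_j\eta_k\,a_{\pi(i),\sigma(j),\tau(k)}\,e_i\otimes e_j\otimes e_k\right\|\le K\left\|\sum_{i,j,k=1}^N a_{i,j,k}\,e_i\otimes e_j\otimes e_k\right\|.$$ Cotype constant: for a norm $\|\cdot\|$ on a finite-dimensional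 real vector space $V$ and $q\in[2,\infty)$, $C_{\|\cdot\|}^{(q)}$ is the infimum of those $C\in(0,\infty)$ such that for every $N\in\mathbb{N}$ and all $x_1,\dots,x_N\in V$, $\left(\sum_{i=1}^N\|x_i\|^q\right)^{1/q}\le C\left(\mathbb{E}\left[\left\|\sum_{i=1}^N\varepsilon_ix_i\right\|^2\right]\right)^{1/2}$, with $\varepsilon$ uniform on $\{-1,1\}^N$. *)

theory Defs
  imports "HOL-Probability.Probability" "HOL-Analysis.Finite_Function_Topology"
    "HOL-Combinatorics.Permutations"
begin

section \<open>Sign vectors and 3-query locally decodable codes\<close>

definition sign_vectors :: "nat \<Rightarrow> (nat \<Rightarrow> real) set" where
  "sign_vectors N = {1..N} \<rightarrow>\<^sub>E {-1, 1}"

text \<open>The tuples (i,j,k,g); extensionality of g makes this the finite set it is on paper.\<close>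

definition decoding_tuples :: "nat \<Rightarrow> (nat \<times> nat \<times> nat \<times> (real \<times> real \<times> real \<Rightarrow> real)) set" where
  "decoding_tuples n =
     {1..n} \<times> {1..n} \<times> {1..n} \<times> ({-1, 1} \<times> {-1, 1} \<times> {-1, 1} \<rightarrow>\<^sub>E {-1, 1})"

definition locally_decodable_code3 ::
  "nat \<Rightarrow> nat \<Rightarrow> real \<Rightarrow> real \<Rightarrow> ((nat \<Rightarrow> real) \<Rightarrow> nat \<Rightarrow> real) \<Rightarrow> bool" where
  "locally_decodable_code3 m n \<phi> \<theta> C \<longleftrightarrow>
     C \<in> sign_vectors m \<rightarrow> sign_vectors n \<and>
     (\<forall>t\<in>{1..m}. \<exists>A. set_pmf A \<subseteq> decoding_tuples n \<and>
        (\<forall>\<epsilon>\<in>sign_vectors m. \<forall>\<delta>\<in>sign_vectors n.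
           real (card {l \<in> {1..n}. \<delta> l \<noteq> C \<epsilon> l}) \<le> \<phi> * real n \<longrightarrow>
           measure_pmf.prob A {(i, j, k, g). g (\<delta> i, \<delta> j, \<delta> k) = \<epsilon> t} \<ge> 1/2 + \<theta>))"


section \<open>Norms on subspaces and cotype constants\<close>

text \<open>Dimensions vary inside the statements, so a normed space is a subspace V of an ambient
  real vector space, with a function p whose values off V are irrelevant.\<close>

definition is_norm_on :: "'v::real_vector set \<Rightarrow> ('v \<Rightarrow> real) \<Rightarrow> bool" where
  "is_norm_on V p \<longleftrightarrow>
     subspace V \<and>
     (\<forall>x\<in>V. 0 \<le> p x) \<and>
     (\<forall>x\<in>V. p x = 0 \<longleftrightarrow> x = 0) \<and>
     (\<forall>c. \<forall>x\<in>V. p (c *\<^sub>R x) = \<bar>c\<bar> * p x) \<and>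
     (\<forall>x\<in>V. \<forall>y\<in>V. p (x + y) \<le> p x + p y)"

definition has_cotype_bound :: "'v::real_vector set \<Rightarrow> ('v \<Rightarrow> real) \<Rightarrow> real \<Rightarrow> real \<Rightarrow> bool" where
  "has_cotype_bound V p q C \<longleftrightarrow>
     (\<forall>N. \<forall>x::nat \<Rightarrow> 'v. (\<forall>i\<in>{1..N}. x i \<in> V) \<longrightarrow>
        (\<Sum>i=1..N. p (x i) powr q) powr (1/q) \<le>
          C * sqrt (measure_pmf.expectation (pmf_of_set (sign_vectors N))
                      (\<lambda>\<epsilon>. (p (\<Sum>i=1..N. \<epsilon> i *\<^sub>R x i))\<^sup>2)))"

text \<open>For a norm p on a finite-dimensional V and q at least 2 this is the infimum of a nonempty
  set, so the convention for the real infimum of the empty set plays no role.\<close>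

definition cotype_const :: "'v::real_vector set \<Rightarrow> ('v \<Rightarrow> real) \<Rightarrow> real \<Rightarrow> real" where
  "cotype_const V p q = Inf {C. 0 < C \<and> has_cotype_bound V p q C}"


section \<open>The threefold tensor power of Euclidean N-space\<close>

text \<open>A tensor is identified with its array of coordinates in the basis of elementary tensors of
  standard basis vectors; the array is a finitely supported function on index triples, whose
  vector space structure is the library's.\<close>

type_synonym tensor3 = "(nat \<times> nat \<times> nat) \<Rightarrow>\<^sub>0 real"

definition tensor_space :: "nat \<Rightarrow> tensor3 set" where
  "tensor_space N = {x. Poly_Mapping.keys x \<subseteq> {1..N} \<times> {1..N} \<times> {1..N}}"

text \<open>The tensor product of the i-th, j-th and k-th standard basis vectors.\<close>

definition e3 :: "nat \<Rightarrow> nat \<Rightarrow> nat \<Rightarrow> tensor3" where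
  "e3 i j k = Poly_Mapping.single (i, j, k) 1"

definition tensor_symmetric :: "nat \<Rightarrow> real \<Rightarrow> (tensor3 \<Rightarrow> real) \<Rightarrow> bool" where
  "tensor_symmetric N K p \<longleftrightarrow>
     (\<forall>\<pi> \<sigma> \<tau>. \<pi> permutes {1..N} \<and> \<sigma> permutes {1..N} \<and> \<tau> permutes {1..N} \<longrightarrow>
       (\<forall>\<epsilon>\<in>sign_vectors N. \<forall>\<delta>\<in>sign_vectors N. \<forall>\<eta>\<in>sign_vectors N.
        \<forall>a :: nat \<Rightarrow> nat \<Rightarrow> nat \<Rightarrow> real.
          p (\<Sum>i=1..N. \<Sum>j=1..N. \<Sum>k=1..N. (\<epsilon> i * \<delta> j * \<eta> k * a (\<pi> i) (\<sigma> j) (\<tau> k)) *\<^sub>R e3 i j k)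
            \<le> K * p (\<Sum>i=1..N. \<Sum>j=1..N. \<Sum>k=1..N. a i j k *\<^sub>R e3 i j k)))"

end

theory Submission
  imports Defs
begin

text \<open>
  Pad a codeword C(\<epsilon>) by ones to a sign vector X(\<epsilon>) of length 3n and consider the tensor-valued
  function f(\<epsilon>) = X(\<epsilon>) \<otimes> X(\<epsilon>) \<otimes> X(\<epsilon>), whose values have norm at most K times the norm of the
  all-ones tensor J. Two estimates of its degree-one Walsh coefficients f(t) are combined with the
  cotype inequality.

  Lower bound: if a set B of at most \<phi>n coordinates of C(\<epsilon>) is overwritten by ones, then the bit t
  can still be decoded, so some Walsh function of at most three coordinates outside B has
  correlation at least \<theta>/4 with it. Iterating gives at least \<phi>n/3 disjoint such query sets, hence
  that many large entries of f(t) on a single generalised diagonal; averaging over signs and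
  permutations shows that the norm of f(t) is at least \<phi>\<theta>/(36K) times that of the diagonal tensor.

  Upper bound: the map sending f to its linear part is, up to a small error in L2, a combination of
  noise operators of total mass O(L). The coefficients come from a quadrature formula for the
  derivative at 0 that is exact on polynomials of degree at most L, rescaled by 1/2 so that the
  degrees above L contribute at most 2L/2^L. With L of order log n the error is harmless even
  after summing over all 27n^3 entries, which is Pisier's bound O(log n) for K-convexity.
\<close>

section \<open>Walsh analysis on the discrete cube\<close>

lemma finite_sign_vectors: "finite (sign_vectors N)"
  unfolding sign_vectors_def by (intro finite_PiE) auto

lemma card_sign_vectors: "card (sign_vectors N) = 2 ^ N"
  unfolding sign_vectors_def by (simp add: card_PiE numeral_2_eq_2)

lemma sign_vectors_nonempty: "sign_vectors N \<noteq> {}"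
  using card_sign_vectors[of N] by auto

lemma sign_vectors_cases: "\<epsilon> \<in> sign_vectors N \<Longrightarrow> i \<in> {1..N} \<Longrightarrow> \<epsilon> i = 1 \<or> \<epsilon> i = -1"
  unfolding sign_vectors_def by (auto dest!: PiE_mem)

text \<open>Distributing the product over the two choices at each coordinate gives one term per sign
  vector. The mass of the noise kernel and the orthogonality of Walsh functions both rest on this
  factorisation.\<close>

lemma sum_sign_vectors_prod:
  fixes h :: "nat \<Rightarrow> real \<Rightarrow> 'a::comm_semiring_1"
  shows "(\<Sum>\<epsilon>\<in>sign_vectors N. \<Prod>i\<in>{1..N}. h i (\<epsilon> i)) = (\<Prod>i\<in>{1..N}. h i 1 + h i (-1))"
proof -
  have "(\<Prod>i\<in>{1..N}. h i 1 + h i (-1)) = (\<Prod>i\<in>{1..N}. \<Sum>x\<in>{-1,1}. h i x)"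
    by (simp add: add.commute)
  also have "\<dots> = (\<Sum>\<epsilon>\<in>sign_vectors N. \<Prod>i\<in>{1..N}. h i (\<epsilon> i))"
    unfolding sign_vectors_def by (subst prod_sum_PiE) auto
  finally show ?thesis ..
qed

lemma sum_swap3:
  "(\<Sum>a\<in>A. \<Sum>b\<in>B. \<Sum>c\<in>C. f a b c) = (\<Sum>b\<in>B. \<Sum>c\<in>C. \<Sum>a\<in>A. f a b c)"
  by (rule trans[OF sum.swap]) (intro sum.cong refl sum.swap)

section \<open>Walsh functions and noise kernels\<close>

definition walsh :: "nat set \<Rightarrow> (nat \<Rightarrow> real) \<Rightarrow> real" where
  "walsh S \<epsilon> = (\<Prod>i\<in>S. \<epsilon> i)"

text \<open>The Riesz product kernel of the noise operator on the cube. The weight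
  \<open>1 / 2 ^ m\<close> of the uniform measure is built in, so the operator is a plain sum over
  \<zeta>.\<close>

definition noise_kernel :: "nat \<Rightarrow> real \<Rightarrow> (nat \<Rightarrow> real) \<Rightarrow> (nat \<Rightarrow> real) \<Rightarrow> real" where
  "noise_kernel m \<rho> \<epsilon> \<zeta> = (\<Prod>i\<in>{1..m}. 1 + \<rho> * \<epsilon> i * \<zeta> i) / 2 ^ m"

definition walsh_coeff :: "nat \<Rightarrow> ((nat \<Rightarrow> real) \<Rightarrow> real) \<Rightarrow> nat set \<Rightarrow> real" where
  "walsh_coeff m f S = (\<Sum>\<epsilon>\<in>sign_vectors m. f \<epsilon> * walsh S \<epsilon>) / 2 ^ m"

lemma walsh_singleton: "walsh {t} \<epsilon> = \<epsilon> t"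
  by (simp add: walsh_def)

text \<open>Each factor is 1 + \<rho> or 1 - \<rho>. With the total mass 1 this makes the noise
  operator an averaging operator, also for negative \<rho>, so it preserves any bound on the norms
  of the values.\<close>

lemma noise_kernel_nonneg:
  assumes "\<bar>\<rho>\<bar> \<le> 1" "\<epsilon> \<in> sign_vectors m" "\<zeta> \<in> sign_vectors m"
  shows "0 \<le> noise_kernel m \<rho> \<epsilon> \<zeta>"
proof -
  have "0 \<le> 1 + \<rho> * \<epsilon> i * \<zeta> i" if "i \<in> {1..m}" for i
    using sign_vectors_cases[OF assms(2) that] sign_vectors_cases[OF assms(3) that] assms(1) by auto
  thus ?thesis by (auto simp: noise_kernel_def intro!: divide_nonneg_nonneg prod_nonneg)
qed

lemma sum_noise_kernel:
  shows "(\<Sum>\<zeta>\<in>sign_vectors m. noise_kernel m \<rho> \<epsilon> \<zeta>) = 1"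
  unfolding noise_kernel_def sum_divide_distrib[symmetric]
  using sum_sign_vectors_prod[of "\<lambda>i x. 1 + \<rho> * \<epsilon> i * x" m] by simp

lemma noise_kernel_walsh:
  "noise_kernel m \<rho> \<epsilon> \<zeta> = (\<Sum>S\<in>Pow {1..m}. \<rho> ^ card S * walsh S \<epsilon> * walsh S \<zeta>) / 2 ^ m"
proof -
  have "(\<Prod>i\<in>{1..m}. \<rho> * \<epsilon> i * \<zeta> i + 1) = (\<Sum>S\<in>Pow {1..m}. (\<Prod>i\<in>S. \<rho> * \<epsilon> i * \<zeta> i) * (\<Prod>i\<in>{1..m}-S. 1))"
    by (rule prod_add) auto
  also have "\<dots> = (\<Sum>S\<in>Pow {1..m}. \<rho> ^ card S * walsh S \<epsilon> * walsh S \<zeta>)"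
    by (intro sum.cong) (auto simp: walsh_def prod.distrib)
  finally show ?thesis by (simp add: noise_kernel_def add.commute)
qed

text \<open>Expanding the Riesz product over subsets diagonalises the operator. A linear combination
  over several \<rho> then acts on level k through the same combination of the numbers
  \<rho>^k.\<close>

lemma noise_operator_walsh:
  "(\<Sum>\<zeta>\<in>sign_vectors m. noise_kernel m \<rho> \<epsilon> \<zeta> * f \<zeta>) =
     (\<Sum>S\<in>Pow {1..m}. \<rho> ^ card S * walsh_coeff m f S * walsh S \<epsilon>)"
proof -
  have "(\<Sum>\<zeta>\<in>sign_vectors m. noise_kernel m \<rho> \<epsilon> \<zeta> * f \<zeta>) =
    (\<Sum>\<zeta>\<in>sign_vectors m. \<Sum>S\<in>Pow {1..m}. \<rho> ^ card S * walsh S \<epsilon> * (f \<zeta> * walsh S \<zeta>) / 2 ^ m)"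
    by (simp add: noise_kernel_walsh sum_divide_distrib sum_distrib_right sum_distrib_left mult_ac)
  also have "\<dots> = (\<Sum>S\<in>Pow {1..m}. \<Sum>\<zeta>\<in>sign_vectors m. \<rho> ^ card S * walsh S \<epsilon> * (f \<zeta> * walsh S \<zeta>) / 2 ^ m)"
    by (rule sum.swap)
  also have "\<dots> = (\<Sum>S\<in>Pow {1..m}. \<rho> ^ card S * walsh_coeff m f S * walsh S \<epsilon>)"
    by (simp add: walsh_coeff_def sum_divide_distrib sum_distrib_right sum_distrib_left mult_ac)
  finally show ?thesis .
qed

section \<open>Orthogonality, Parseval and inversion\<close>

lemma walsh_orthonormal:
  assumes "S \<subseteq> {1..m}" "T \<subseteq> {1..m}"
  shows "(\<Sum>\<epsilon>\<in>sign_vectors m. walsh S \<epsilon> * walsh T \<epsilon>) = (if S = T then 2 ^ m else 0)"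
proof -
  \<comment> \<open>Both Walsh functions become products over all of {1..m}, with factor 1 off the
    set, so the sum factorises. An index in exactly one of S and T gives the factor 1 + (-1) =
    0.\<close>
  define h where "h i x = (if i \<in> S then x else 1) * (if i \<in> T then x else (1::real))" for i x
  have S: "walsh U \<epsilon> = (\<Prod>i\<in>{1..m}. if i \<in> U then \<epsilon> i else 1)" if "U \<subseteq> {1..m}" for U \<epsilon>
    unfolding walsh_def using that by (simp add: prod.inter_restrict[symmetric] Int_absorb1)
  have "(\<Sum>\<epsilon>\<in>sign_vectors m. walsh S \<epsilon> * walsh T \<epsilon>) = (\<Sum>\<epsilon>\<in>sign_vectors m. \<Prod>i\<in>{1..m}. h i (\<epsilon> i))"
    unfolding S[OF assms(1)] S[OF assms(2)] prod.distrib[symmetric] h_def ..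
  also have "\<dots> = (\<Prod>i\<in>{1..m}. h i 1 + h i (-1))" by (rule sum_sign_vectors_prod)
  also have "\<dots> = (if S = T then 2 ^ m else 0)"
  proof (cases "S = T")
    case True
    have "h i 1 + h i (-1) = 2" for i by (simp add: h_def True)
    thus ?thesis by (simp add: True)
  next
    case False
    then obtain i where "i \<in> S \<and> i \<notin> T \<or> i \<in> T \<and> i \<notin> S" by blast
    hence "i \<in> {1..m}" "h i 1 + h i (-1) = 0" using assms by (auto simp: h_def)
    thus ?thesis using False by (metis prod_zero finite_atLeastAtMost)
  qed
  finally show ?thesis .
qed

lemma walsh_expansion_parseval:
  "(\<Sum>\<epsilon>\<in>sign_vectors m. (\<Sum>S\<in>Pow {1..m}. c S * walsh S \<epsilon>)\<^sup>2) = 2 ^ m * (\<Sum>S\<in>Pow {1..m}. (c S)\<^sup>2)"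
proof -
  have "(\<Sum>\<epsilon>\<in>sign_vectors m. (\<Sum>S\<in>Pow {1..m}. c S * walsh S \<epsilon>)\<^sup>2) =
    (\<Sum>\<epsilon>\<in>sign_vectors m. \<Sum>S\<in>Pow {1..m}. \<Sum>T\<in>Pow {1..m}. c S * c T * (walsh S \<epsilon> * walsh T \<epsilon>))"
    by (simp add: power2_eq_square sum_product mult_ac)
  also have "\<dots> = (\<Sum>S\<in>Pow {1..m}. \<Sum>T\<in>Pow {1..m}. \<Sum>\<epsilon>\<in>sign_vectors m. c S * c T * (walsh S \<epsilon> * walsh T \<epsilon>))"
    by (rule sum_swap3)
  also have "\<dots> = (\<Sum>S\<in>Pow {1..m}. \<Sum>T\<in>Pow {1..m}. if S = T then 2 ^ m * (c S)\<^sup>2 else 0)"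
    by (intro sum.cong refl) (auto simp: sum_distrib_left[symmetric] walsh_orthonormal power2_eq_square)
  also have "\<dots> = 2 ^ m * (\<Sum>S\<in>Pow {1..m}. (c S)\<^sup>2)"
    by (simp add: sum_distrib_left)
  finally show ?thesis .
qed

text \<open>At \<rho> = 1 the noise kernel is the point mass at \<epsilon>, so inversion is a
  special case of the diagonalisation.\<close>

lemma walsh_inversion:
  assumes "\<epsilon> \<in> sign_vectors m"
  shows "f \<epsilon> = (\<Sum>S\<in>Pow {1..m}. walsh_coeff m f S * walsh S \<epsilon>)"
proof -
  have ker: "noise_kernel m 1 \<epsilon> \<zeta> = (if \<zeta> = \<epsilon> then 1 else 0)" if z: "\<zeta> \<in> sign_vectors m" for \<zeta>
  proof (cases "\<zeta> = \<epsilon>")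
    case True
    have "1 + 1 * \<epsilon> i * \<epsilon> i = 2" if "i \<in> {1..m}" for i
      using sign_vectors_cases[OF assms that] by auto
    thus ?thesis by (simp add: noise_kernel_def True)
  next
    case False
    then obtain i where i: "i \<in> {1..m}" "\<epsilon> i \<noteq> \<zeta> i"
      using assms z unfolding sign_vectors_def by (metis PiE_ext)
    hence "1 + 1 * \<epsilon> i * \<zeta> i = 0"
      using sign_vectors_cases[OF assms i(1)] sign_vectors_cases[OF z i(1)] by auto
    hence "(\<Prod>i\<in>{1..m}. 1 + 1 * \<epsilon> i * \<zeta> i) = 0" using i(1) by (meson prod_zero finite_atLeastAtMost)
    thus ?thesis using False by (simp add: noise_kernel_def)
  qed
  have "f \<epsilon> = (\<Sum>\<zeta>\<in>sign_vectors m. noise_kernel m 1 \<epsilon> \<zeta> * f \<zeta>)"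
    using assms by (simp add: ker finite_sign_vectors if_distrib[of "\<lambda>x. x * _"] cong: if_cong)
  thus ?thesis by (simp add: noise_operator_walsh)
qed

lemma walsh_parseval:
  "(\<Sum>S\<in>Pow {1..m}. (walsh_coeff m f S)\<^sup>2) = (\<Sum>\<epsilon>\<in>sign_vectors m. (f \<epsilon>)\<^sup>2) / 2 ^ m"
proof -
  have "(\<Sum>\<epsilon>\<in>sign_vectors m. (f \<epsilon>)\<^sup>2) =
      (\<Sum>\<epsilon>\<in>sign_vectors m. (\<Sum>S\<in>Pow {1..m}. walsh_coeff m f S * walsh S \<epsilon>)\<^sup>2)"
    by (intro sum.cong refl arg_cong[where f = "\<lambda>x. x\<^sup>2"] walsh_inversion)
  thus ?thesis unfolding walsh_expansion_parseval by (simp del: One_nat_def)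
qed

section \<open>Extracting the linear part from noise operators\<close>

lemma sum_roots_of_unity:
  fixes M :: nat and b :: int
  assumes "\<bar>b\<bar> < int M"
  shows "(\<Sum>s<M. cis (of_int b * (2 * pi * real s / real M))) = (if b = 0 then of_nat M else 0)"
proof (cases "b = 0")
  case False
  define z where "z = cis (2 * pi * of_int b / real M)"
  have M: "M > 0" using assms by auto
  have pow: "cis (of_int b * (2 * pi * real s / real M)) = z ^ s" for s
  proof -
    have "z ^ s = cis (real s * (2 * pi * of_int b / real M))" unfolding z_def by (rule Complex.DeMoivre)
    thus ?thesis by (simp add: mult_ac)
  qed
  have "z ^ M = 1"
  proof -
    have "z ^ M = cis (real M * (2 * pi * of_int b / real M))" unfolding z_def by (rule Complex.DeMoivre)
    also have "real M * (2 * pi * of_int b / real M) = 2 * pi * of_int b" using M by simp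
    finally show ?thesis by (simp add: cis_multiple_2pi)
  qed
  moreover have "z \<noteq> 1"
  proof
    assume "z = 1"
    hence "cos (2 * pi * of_int b / real M) = 1" unfolding z_def by (metis cis.sel(1) one_complex.sel(1))
    then obtain x :: int where "2 * pi * of_int b / real M = of_int x * 2 * pi"
      using cos_one_2pi_int by blast
    hence "real_of_int b = of_int x * real M" using M by (simp add: field_simps)
    hence "b = x * int M" by (metis of_int_eq_iff of_int_mult of_int_of_nat_eq)
    hence "int M dvd b" by simp
    thus False using assms False by (auto dest: dvd_imp_le_int)
  qed
  ultimately show ?thesis using False unfolding pow by (simp add: sum_gp_strict)
qed simp

text \<open>These counts are the triangular coefficients of the Fejer kernel. The maximum with 0
  covers |d| > L, which occurs once frequencies are shifted by L.\<close>

lemma sum_diff_indicator: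
  fixes d :: int
  shows "(\<Sum>j<L. \<Sum>l<L. if int j - int l = d then 1 else 0 :: real) = max 0 (real L - \<bar>of_int d\<bar>)"
proof -
  have nonneg: "(\<Sum>j<L. \<Sum>l<L. if int j - int l = int e then 1 else 0 :: real) = max 0 (real L - real e)" for e
  proof -
    have "(\<Sum>j<L. \<Sum>l<L. if int j - int l = int e then 1 else 0 :: real) =
        (\<Sum>l<L. \<Sum>j<L. if j = l + e then 1 else 0)"
      by (subst sum.swap, intro sum.cong refl) auto
    also have "\<dots> = (\<Sum>l<L. if l < L - e then 1 else 0)"
      by (intro sum.cong refl) auto
    also have "\<dots> = real (card ({..<L} \<inter> {l. l < L - e}))" by (simp add: sum.If_cases)
    also have "{..<L} \<inter> {l. l < L - e} = {..<L - e}" by auto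
    finally show ?thesis by auto
  qed
  show ?thesis
  proof (cases "d \<ge> 0")
    case True
    thus ?thesis using nonneg[of "nat d"] by simp
  next
    case False
    have "(\<Sum>j<L. \<Sum>l<L. if int j - int l = d then 1 else 0 :: real) =
        (\<Sum>l<L. \<Sum>j<L. if int l - int j = int (nat (- d)) then 1 else 0)"
      using False by (subst sum.swap, intro sum.cong refl) auto
    thus ?thesis using nonneg[of "nat (- d)"] False by simp
  qed
qed

lemma cmod_sum_cis_squared:
  "complex_of_real ((cmod (\<Sum>j<L. cis (real j * t)))\<^sup>2) =
     (\<Sum>j<L. \<Sum>l<L. cis (of_int (int j - int l) * t))"
  by (subst complex_norm_square) (simp add: sum_product cis_mult cis_cnj left_diff_distrib)

text \<open>The weights are the samples at the 4L-th roots of unity of 2L sin(Lt) times the Fejer kernel,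
  up to normalisation; its total mass is controlled by the positivity of the Fejer kernel.\<close>

lemma trigonometric_differentiation_weights:
  fixes L :: nat
  assumes "L \<ge> 1"
  defines "t \<equiv> \<lambda>s. 2 * pi * real s / real (4 * L)"
  obtains w :: "nat \<Rightarrow> real"
    where "(\<Sum>s<4*L. \<bar>w s\<bar>) \<le> 2 * real L"
      and "\<And>a::int. \<bar>a\<bar> \<le> int L \<Longrightarrow> (\<Sum>s<4*L. w s * cis (of_int a * t s)) = \<i> * of_int a"
proof
  \<comment> \<open>\<open>D\<close> is the unnormalised Fejer kernel; the factor sin(L t) in
    \<open>w\<close> shifts its frequencies by L and by -L.\<close>
  define D where "D x = (cmod (\<Sum>j<L. cis (real j * x)))\<^sup>2" for x
  define w where "w s = sin (L * t s) * D (t s) / (2 * L)" for s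
  have orth: "(\<Sum>s<4*L. cis (of_int b * t s)) = (if b = 0 then 4 * of_nat L else 0)"
    if "\<bar>b\<bar> < 4 * int L" for b
    using sum_roots_of_unity[of b "4 * L"] that by (simp add: t_def)
  have D0: "D x \<ge> 0" for x by (simp add: D_def)
  have "complex_of_real (\<Sum>s<4*L. D (t s)) =
      (\<Sum>s<4*L. \<Sum>j<L. \<Sum>l<L. cis (of_int (int j - int l) * t s))"
    unfolding D_def of_real_sum cmod_sum_cis_squared ..
  also have "\<dots> = (\<Sum>j<L. \<Sum>l<L. \<Sum>s<4*L. cis (of_int (int j - int l) * t s))"
    by (rule sum_swap3)
  also have "\<dots> = (\<Sum>j<L. \<Sum>l<L. if int j - int l = 0 then 4 * of_nat L else 0)"
    by (intro sum.cong refl orth) auto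
  also have "\<dots> = (\<Sum>j<L. 4 * of_nat L)" by (intro sum.cong refl) auto
  also have "\<dots> = complex_of_real (4 * L * L)" by simp
  finally have sumD: "(\<Sum>s<4*L. D (t s)) = 4 * real L * real L" unfolding of_real_eq_iff by simp
  have "(\<Sum>s<4*L. \<bar>w s\<bar>) \<le> (\<Sum>s<4*L. D (t s) / (2 * L))"
  proof (intro sum_mono)
    fix s
    have "\<bar>sin (L * t s)\<bar> * D (t s) \<le> 1 * D (t s)" by (intro mult_right_mono D0) auto
    thus "\<bar>w s\<bar> \<le> D (t s) / (2 * L)"
      using D0[of "t s"] by (simp add: w_def abs_mult divide_right_mono)
  qed
  also have "\<dots> = 2 * real L" using assms(1) by (simp add: sum_divide_distrib[symmetric] sumD)
  finally show "(\<Sum>s<4*L. \<bar>w s\<bar>) \<le> 2 * real L" .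
  show "(\<Sum>s<4*L. w s * cis (of_int a * t s)) = \<i> * of_int a" if a: "\<bar>a\<bar> \<le> int L" for a :: int
  proof -
    have sin_cis: "complex_of_real (sin x) = (cis x - cis (- x)) / (2 * \<i>)" for x
      by (simp add: complex_eq_iff)
    let ?e = "\<lambda>b s. cis (of_int b * t s)"
    have step: "w s * ?e a s = (\<Sum>j<L. \<Sum>l<L. ?e (int j - int l + L + a) s - ?e (int j - int l - L + a) s) / (4 * L * \<i>)" for s
    proof -
      have rearrange: "u / (2 * c) * d / (2 * l) * e = u * d * e / (4 * l * c)" for u c d l e :: complex
        by simp
      have "complex_of_real (sin (L * t s)) = (?e L s - ?e (- int L) s) / (2 * \<i>)"
        by (simp add: sin_cis)
      hence "w s * ?e a s = ((?e L s - ?e (- int L) s) * (\<Sum>j<L. \<Sum>l<L. ?e (int j - int l) s) * ?e a s) / (4 * L * \<i>)"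
        unfolding w_def D_def of_real_mult of_real_divide cmod_sum_cis_squared
        by (simp only: rearrange of_nat_mult of_nat_numeral of_real_mult of_real_numeral of_real_of_nat_eq)
      also have "(?e L s - ?e (- int L) s) * (\<Sum>j<L. \<Sum>l<L. ?e (int j - int l) s) * ?e a s =
          (\<Sum>j<L. \<Sum>l<L. ?e (int j - int l + L + a) s - ?e (int j - int l - L + a) s)"
        unfolding sum_distrib_left sum_distrib_right
        by (intro sum.cong refl) (simp add: left_diff_distrib right_diff_distrib cis_mult distrib_right algebra_simps)
      finally show ?thesis .
    qed
    have "(\<Sum>s<4*L. w s * ?e a s) =
        (\<Sum>s<4*L. \<Sum>j<L. \<Sum>l<L. ?e (int j - int l + L + a) s - ?e (int j - int l - L + a) s) / (4 * L * \<i>)"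
      unfolding step sum_divide_distrib ..
    also have "(\<Sum>s<4*L. \<Sum>j<L. \<Sum>l<L. ?e (int j - int l + L + a) s - ?e (int j - int l - L + a) s) =
        (\<Sum>j<L. \<Sum>l<L. \<Sum>s<4*L. ?e (int j - int l + L + a) s - ?e (int j - int l - L + a) s)"
      by (rule sum_swap3)
    also have "\<dots> = (\<Sum>j<L. \<Sum>l<L. 4 * complex_of_real L * of_real ((if int j - int l = - int L - a then 1 else 0) -
         (if int j - int l = int L - a then 1 else 0)))"
    proof (intro sum.cong refl)
      \<comment> \<open>No aliasing: |j - l| < L and |a| <= L, so the shifted frequencies stay below
        3L in modulus, while there are 4L sample points.\<close>
      fix j l assume "j \<in> {..<L}" "l \<in> {..<L}"
      hence jl: "\<bar>int j - int l + int L + a\<bar> < 4 * int L" "\<bar>int j - int l - int L + a\<bar> < 4 * int L"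
        using a by auto
      have "(\<Sum>s<4*L. ?e (int j - int l + L + a) s - ?e (int j - int l - L + a) s) =
          (if int j - int l + int L + a = 0 then 4 * of_nat L else 0) - (if int j - int l - int L + a = 0 then 4 * of_nat L else 0)"
        unfolding sum_subtractf orth[OF jl(1)] orth[OF jl(2)] ..
      also have "int j - int l + int L + a = 0 \<longleftrightarrow> int j - int l = - int L - a" by linarith
      also have "int j - int l - int L + a = 0 \<longleftrightarrow> int j - int l = int L - a" by linarith
      finally show "(\<Sum>s<4*L. ?e (int j - int l + L + a) s - ?e (int j - int l - L + a) s) =
          4 * complex_of_real L * of_real ((if int j - int l = - int L - a then 1 else 0) - (if int j - int l = int L - a then 1 else 0))"
        by (simp only: of_real_diff of_real_0 of_real_1 right_diff_distrib if_distrib[of of_real] if_distrib[of "\<lambda>x. _ * x"] mult_1_right mult_zero_right of_real_of_nat_eq)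
    qed
    also have "\<dots> = 4 * complex_of_real L * of_real ((\<Sum>j<L. \<Sum>l<L. if int j - int l = - int L - a then 1 else 0) -
       (\<Sum>j<L. \<Sum>l<L. if int j - int l = int L - a then 1 else 0))"
      by (simp add: sum_distrib_left sum_subtractf right_diff_distrib)
    \<comment> \<open>Of the two values of the triangle one is |a| and the other 0, and their
      difference is -a for either sign of a.\<close>
    also have "\<dots> = 4 * complex_of_real L * of_real (- of_int a)"
      unfolding sum_diff_indicator using a by (auto simp: max_def)
    finally show ?thesis using assms(1) by (simp add: field_simps)
  qed
qed

text \<open>Substituting x = sin t turns a polynomial of degree at most L into a trigonometric
  polynomial of degree at most L. Its derivative at t = 0 is that of the polynomial at 0, because
  cos 0 = 1.\<close>

lemma derivative_weights:
  fixes L :: nat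
  assumes "L \<ge> 1"
  obtains w x :: "nat \<Rightarrow> real"
    where "(\<Sum>s<4*L. \<bar>w s\<bar>) \<le> 2 * real L" "\<And>s. \<bar>x s\<bar> \<le> 1"
      and "\<And>k. k \<le> L \<Longrightarrow> (\<Sum>s<4*L. w s * x s ^ k) = (if k = 1 then 1 else 0)"
proof -
  define t where "t s = 2 * pi * real s / real (4 * L)" for s
  obtain w where w: "(\<Sum>s<4*L. \<bar>w s\<bar>) \<le> 2 * real L"
    and diff: "\<And>a::int. \<bar>a\<bar> \<le> int L \<Longrightarrow> (\<Sum>s<4*L. w s * cis (of_int a * t s)) = \<i> * of_int a"
    using trigonometric_differentiation_weights[OF assms] unfolding t_def by blast
  \<comment> \<open>The right-hand side is the derivative at 0 of exp(i a t) sin(t)^k. The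
    exponential factor closes the induction: rewriting one sine moves a by one and lowers k by one,
    within the budget |a| + k <= L.\<close>
  have ind: "(\<Sum>s<4*L. w s * (cis (of_int a * t s) * of_real (sin (t s)) ^ k)) =
      (if k = 0 then \<i> * of_int a else if k = 1 then 1 else 0)"
    if "\<bar>a\<bar> + int k \<le> int L" for a k
    using that
  proof (induction k arbitrary: a)
    case 0
    thus ?case using diff[of a] by simp
  next
    case (Suc k)
    have sin_cis: "complex_of_real (sin x) = (cis x - cis (- x)) / (2 * \<i>)" for x
      by (simp add: complex_eq_iff)
    have "(\<Sum>s<4*L. w s * (cis (of_int a * t s) * of_real (sin (t s)) ^ Suc k)) =
      ((\<Sum>s<4*L. w s * (cis (of_int (a + 1) * t s) * of_real (sin (t s)) ^ k)) -
       (\<Sum>s<4*L. w s * (cis (of_int (a - 1) * t s) * of_real (sin (t s)) ^ k))) / (2 * \<i>)"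
      unfolding sum_subtractf[symmetric] sum_divide_distrib
    proof (intro sum.cong refl)
      fix s
      have eq: "cis (of_int a * t s) * of_real (sin (t s)) = (cis (of_int (a + 1) * t s) - cis (of_int (a - 1) * t s)) / (2 * \<i>)"
        unfolding sin_cis by (simp add: right_diff_distrib cis_mult algebra_simps)
      show "w s * (cis (of_int a * t s) * of_real (sin (t s)) ^ Suc k) =
         (w s * (cis (of_int (a + 1) * t s) * of_real (sin (t s)) ^ k) -
          w s * (cis (of_int (a - 1) * t s) * of_real (sin (t s)) ^ k)) / (2 * \<i>)"
      proof -
        let ?c = "w s * of_real (sin (t s)) ^ k :: complex"
        have "w s * (cis (of_int a * t s) * of_real (sin (t s)) ^ Suc k) =
            ?c * (cis (of_int a * t s) * of_real (sin (t s)))" by simp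
        also note eq
        finally show ?thesis by (simp add: right_diff_distrib mult_ac)
      qed
    qed
    also have "\<dots> = (if Suc k = 0 then \<i> * of_int a else if Suc k = 1 then 1 else 0)"
      using Suc.prems by (subst (1 2) Suc.IH) (auto simp: algebra_simps)
    finally show ?case .
  qed
  show ?thesis
  proof (rule that[of w "\<lambda>s. sin (t s)"])
    fix k assume "k \<le> L"
    hence "complex_of_real (\<Sum>s<4*L. w s * sin (t s) ^ k) = of_real (if k = 1 then 1 else 0)"
      using ind[of 0 k] by simp
    thus "(\<Sum>s<4*L. w s * sin (t s) ^ k) = (if k = 1 then 1 else 0)" by (simp only: of_real_eq_iff)
  qed (use w in auto)
qed

text \<open>Halving the nodes scales degree k by 2^-k, and doubling the weights restores degree 1.
  Beyond degree L only the total mass controls the error, and the halving makes it small in every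
  degree, whatever the dimension of the cube.\<close>

lemma linear_part_weights:
  fixes L :: nat
  assumes "L \<ge> 1"
  obtains w x :: "nat \<Rightarrow> real"
    where "(\<Sum>s<4*L. \<bar>w s\<bar>) \<le> 4 * real L" "\<And>s. \<bar>x s\<bar> \<le> 1"
      and "\<And>k. \<bar>(\<Sum>s<4*L. w s * x s ^ k) - (if k = 1 then 1 else 0)\<bar> \<le> 2 * real L / 2 ^ L"
proof -
  obtain w x :: "nat \<Rightarrow> real" where w: "(\<Sum>s<4*L. \<bar>w s\<bar>) \<le> 2 * real L" and x: "\<And>s. \<bar>x s\<bar> \<le> 1"
    and ex: "\<And>k. k \<le> L \<Longrightarrow> (\<Sum>s<4*L. w s * x s ^ k) = (if k = 1 then 1 else 0)"
    using derivative_weights[OF assms] by blast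
  have scale: "(\<Sum>s<4*L. 2 * w s * (x s / 2) ^ k) = 2 / 2 ^ k * (\<Sum>s<4*L. w s * x s ^ k)" for k
    by (simp add: sum_distrib_left power_divide mult_ac)
  show ?thesis
  proof (rule that[of "\<lambda>s. 2 * w s" "\<lambda>s. x s / 2"])
    show "(\<Sum>s<4*L. \<bar>2 * w s\<bar>) \<le> 4 * real L"
      using w by (simp add: abs_mult sum_distrib_left[symmetric])
    show "\<bar>x s / 2\<bar> \<le> 1" for s using x[of s] by simp
    fix k
    show "\<bar>(\<Sum>s<4*L. 2 * w s * (x s / 2) ^ k) - (if k = 1 then 1 else 0)\<bar> \<le> 2 * real L / 2 ^ L"
    proof (cases "k \<le> L")
      case True
      thus ?thesis unfolding scale ex[OF True] by simp
    next
      case False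
      have "\<bar>\<Sum>s<4*L. w s * x s ^ k\<bar> \<le> (\<Sum>s<4*L. \<bar>w s * x s ^ k\<bar>)" by (rule sum_abs)
      also have "\<dots> \<le> (\<Sum>s<4*L. \<bar>w s\<bar>)"
        by (intro sum_mono) (simp add: abs_mult power_abs mult_left_le power_le_one x)
      finally have "\<bar>\<Sum>s<4*L. w s * x s ^ k\<bar> \<le> 2 * real L" using w by simp
      hence "\<bar>2 / 2 ^ k * (\<Sum>s<4*L. w s * x s ^ k)\<bar> \<le> 2 / 2 ^ k * (2 * real L)"
        unfolding abs_mult by (intro mult_mono) auto
      \<comment> \<open>Here k is at least L + 1, and the extra halving absorbs the doubled
        weights.\<close>
      also have "\<dots> \<le> 2 / 2 ^ Suc L * (2 * real L)"
        using False by (intro mult_right_mono divide_left_mono power_increasing) auto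
      finally show ?thesis using False assms unfolding scale by auto
    qed
  qed
qed

section \<open>Disjoint query sets of a locally decodable code\<close>

lemma walsh_decomposition:
  fixes h :: "(nat \<Rightarrow> real) \<Rightarrow> real"
  assumes "finite R"
    and "\<And>x. \<forall>i. x i \<in> {-1, 1} \<Longrightarrow> \<bar>h x\<bar> \<le> 1"
    and "\<And>x y. \<forall>i. x i \<in> {-1, 1} \<Longrightarrow> \<forall>i. y i \<in> {-1, 1} \<Longrightarrow> \<forall>i\<in>R. x i = y i \<Longrightarrow> h x = h y"
  obtains c where "\<And>S. \<bar>c S\<bar> \<le> (1::real)"
    and "\<And>x. \<forall>i. x i \<in> {-1, 1} \<Longrightarrow> h x = (\<Sum>S\<in>Pow R. c S * walsh S x)"
proof -
  have "\<exists>c. (\<forall>S. \<bar>c S\<bar> \<le> (1::real)) \<and> (\<forall>x. (\<forall>i. x i \<in> {-1, 1}) \<longrightarrow> h x = (\<Sum>S\<in>Pow R. c S * walsh S x))"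
    using assms
  proof (induction R arbitrary: h rule: finite_induct)
    case empty
    have const: "h x = h (\<lambda>_. 1)" if "\<forall>i. x i \<in> {-1, 1}" for x
      by (rule empty.prems(2)) (use that in simp_all)
    show ?case
    proof (intro exI[of _ "\<lambda>_. h (\<lambda>_. 1)"] conjI allI impI)
      show "\<bar>h (\<lambda>_. 1)\<bar> \<le> 1" by (rule empty.prems(1)) simp
      fix x :: "nat \<Rightarrow> real" assume "\<forall>i. x i \<in> {-1, 1}"
      from const[OF this] show "h x = (\<Sum>S\<in>Pow {}. h (\<lambda>_. 1) * walsh S x)"
        by (simp only: Pow_empty) (simp add: walsh_def)
    qed
  next
    case (insert r R)
    \<comment> \<open>One coordinate is split off: \<open>h x = hp x + x r * hm x\<close> with the
      half-sum and half-difference over the two values at r. Both have modulus at most 1 and do not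
      depend on coordinate r, so the coefficients stay bounded by 1.\<close>
    define hp where "hp x = (h (x(r := 1)) + h (x(r := -1))) / 2" for x
    define hm where "hm x = (h (x(r := 1)) - h (x(r := -1))) / 2" for x
    have b: "\<bar>h (x(r := 1))\<bar> \<le> 1" "\<bar>h (x(r := -1))\<bar> \<le> 1" if "\<forall>i. x i \<in> {-1, 1}" for x
      by (rule insert.prems(1), use that in simp)+
    have e: "h (x(r := 1)) = h (y(r := 1))" "h (x(r := -1)) = h (y(r := -1))"
      if "\<forall>i. x i \<in> {-1, 1}" "\<forall>i. y i \<in> {-1, 1}" "\<forall>i\<in>R. x i = y i" for x y
      by (rule insert.prems(2); use that in simp)+
    have "\<exists>c. (\<forall>S. \<bar>c S\<bar> \<le> (1::real)) \<and> (\<forall>x. (\<forall>i. x i \<in> {-1, 1}) \<longrightarrow> hp x = (\<Sum>S\<in>Pow R. c S * walsh S x))"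
    proof (rule insert.IH)
      show "\<bar>hp x\<bar> \<le> 1" if "\<forall>i. x i \<in> {-1, 1}" for x
        using b[OF that] by (simp add: hp_def abs_le_iff)
      show "hp x = hp y" if "\<forall>i. x i \<in> {-1, 1}" "\<forall>i. y i \<in> {-1, 1}" "\<forall>i\<in>R. x i = y i" for x y
        unfolding hp_def e[OF that] ..
    qed
    then obtain cp where cp: "\<And>S. \<bar>cp S\<bar> \<le> 1" "\<And>x. \<forall>i. x i \<in> {-1, 1} \<Longrightarrow> hp x = (\<Sum>S\<in>Pow R. cp S * walsh S x)"
      by blast
    have "\<exists>c. (\<forall>S. \<bar>c S\<bar> \<le> (1::real)) \<and> (\<forall>x. (\<forall>i. x i \<in> {-1, 1}) \<longrightarrow> hm x = (\<Sum>S\<in>Pow R. c S * walsh S x))"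
    proof (rule insert.IH)
      show "\<bar>hm x\<bar> \<le> 1" if "\<forall>i. x i \<in> {-1, 1}" for x
        using b[OF that] by (simp add: hm_def abs_le_iff)
      show "hm x = hm y" if "\<forall>i. x i \<in> {-1, 1}" "\<forall>i. y i \<in> {-1, 1}" "\<forall>i\<in>R. x i = y i" for x y
        unfolding hm_def e[OF that] ..
    qed
    then obtain cm where cm: "\<And>S. \<bar>cm S\<bar> \<le> 1" "\<And>x. \<forall>i. x i \<in> {-1, 1} \<Longrightarrow> hm x = (\<Sum>S\<in>Pow R. cm S * walsh S x)"
      by blast
    define c where "c S = (if r \<in> S then cm (S - {r}) else cp S)" for S
    have "h x = (\<Sum>S\<in>Pow (insert r R). c S * walsh S x)" if x: "\<forall>i. x i \<in> {-1, 1}" for x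
    proof -
      have "x r = 1 \<and> h x = h (x(r := 1)) \<or> x r = -1 \<and> h x = h (x(r := -1))"
        using x[rule_format, of r] fun_upd_triv[of x r] by (metis insertE singletonD)
      hence "h x = hp x + x r * hm x" unfolding hp_def hm_def by (elim disjE conjE) (simp_all add: field_simps)
      also have "\<dots> = (\<Sum>S\<in>Pow R. cp S * walsh S x) + (\<Sum>S\<in>Pow R. cm S * (x r * walsh S x))"
        by (simp add: cp(2)[OF x] cm(2)[OF x] sum_distrib_left mult_ac)
      also have "(\<Sum>S\<in>Pow R. cp S * walsh S x) = (\<Sum>S\<in>Pow R. c S * walsh S x)"
        using insert.hyps by (intro sum.cong refl) (auto simp: c_def)
      also have "(\<Sum>S\<in>Pow R. cm S * (x r * walsh S x)) = (\<Sum>S\<in>Pow R. c (insert r S) * walsh (insert r S) x)"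
      proof (intro sum.cong refl)
        fix S assume "S \<in> Pow R"
        hence "r \<notin> S" "finite S" using insert.hyps finite_subset by auto
        thus "cm S * (x r * walsh S x) = c (insert r S) * walsh (insert r S) x"
          by (simp add: c_def walsh_def)
      qed
      also have "\<dots> = (\<Sum>S\<in>insert r ` Pow R. c S * walsh S x)"
        using insert.hyps by (subst sum.reindex) (auto simp: inj_on_def)
      also have "(\<Sum>S\<in>Pow R. c S * walsh S x) + (\<Sum>S\<in>insert r ` Pow R. c S * walsh S x) =
          (\<Sum>S\<in>Pow (insert r R). c S * walsh S x)"
        using insert.hyps by (subst Pow_insert, subst sum.union_disjoint) auto
      finally show ?thesis .
    qed
    moreover have "\<bar>c S\<bar> \<le> 1" for S using cp(1) cm(1) by (simp add: c_def)
    ultimately show ?case by blast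
  qed
  thus ?thesis using that by blast
qed

text \<open>Overwriting B by ones alters at most \<phi> n positions of a codeword, so every message
  is decoded with probability at least 1/2 + \<theta>. Averaging over messages and exchanging the
  sums leaves one deterministic tuple doing as well, and a success rate 1/2 + \<theta> is a
  correlation 2 \<theta>.\<close>

lemma decoding_correlation:
  assumes code: "locally_decodable_code3 m n \<phi> \<theta> C" and t: "t \<in> {1..m}"
    and B: "B \<subseteq> {1..n}" "real (card B) \<le> \<phi> * real n"
  defines "C\<^sub>B \<equiv> \<lambda>\<epsilon> l. if l \<in> B then 1 else C \<epsilon> l"
  obtains i j k g where "(i, j, k, g) \<in> decoding_tuples n"
    and "2 * \<theta> * 2 ^ m \<le> (\<Sum>\<epsilon>\<in>sign_vectors m. \<epsilon> t * g (C\<^sub>B \<epsilon> i, C\<^sub>B \<epsilon> j, C\<^sub>B \<epsilon> k))"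
proof -
  let ?D = "decoding_tuples n"
  obtain A where A: "set_pmf A \<subseteq> ?D"
    and dec: "\<And>\<epsilon> \<delta>. \<epsilon> \<in> sign_vectors m \<Longrightarrow> \<delta> \<in> sign_vectors n \<Longrightarrow>
           real (card {l \<in> {1..n}. \<delta> l \<noteq> C \<epsilon> l}) \<le> \<phi> * real n \<Longrightarrow>
           measure_pmf.prob A {(i, j, k, g). g (\<delta> i, \<delta> j, \<delta> k) = \<epsilon> t} \<ge> 1/2 + \<theta>"
    using code t unfolding locally_decodable_code3_def by meson
  have C: "C \<epsilon> \<in> sign_vectors n" if "\<epsilon> \<in> sign_vectors m" for \<epsilon>
    using code that unfolding locally_decodable_code3_def by auto
  have fin: "finite ?D" unfolding decoding_tuples_def by (intro finite_cartesian_product finite_PiE) auto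
  define W where "W = (\<lambda>(i, j, k, g). \<Sum>\<epsilon>\<in>sign_vectors m. if g (C\<^sub>B \<epsilon> i, C\<^sub>B \<epsilon> j, C\<^sub>B \<epsilon> k) = \<epsilon> t then 1 else 0 :: real)"
  have prob: "measure_pmf.prob A E = (\<Sum>\<tau>\<in>?D. pmf A \<tau> * (if \<tau> \<in> E then 1 else 0))" for E
  proof -
    have "measure_pmf.prob A E = measure_pmf.expectation A (indicator E)" by simp
    also have "\<dots> = (\<Sum>\<tau>\<in>?D. indicator E \<tau> * pmf A \<tau>)"
      using A fin by (intro integral_measure_pmf_real) auto
    finally show ?thesis unfolding indicator_def of_bool_def by (simp only: mult.commute)
  qed
  have "(1/2 + \<theta>) * 2 ^ m = (\<Sum>\<epsilon>\<in>sign_vectors m. 1/2 + \<theta>)" by (simp add: card_sign_vectors)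
  also have "\<dots> \<le> (\<Sum>\<epsilon>\<in>sign_vectors m. measure_pmf.prob A {(i, j, k, g). g (C\<^sub>B \<epsilon> i, C\<^sub>B \<epsilon> j, C\<^sub>B \<epsilon> k) = \<epsilon> t})"
  proof (intro sum_mono dec)
    fix \<epsilon> assume e: "\<epsilon> \<in> sign_vectors m"
    show "C\<^sub>B \<epsilon> \<in> sign_vectors n"
      using C[OF e] B(1) unfolding sign_vectors_def C\<^sub>B_def by (auto simp: PiE_iff extensional_def)
    have "card {l \<in> {1..n}. C\<^sub>B \<epsilon> l \<noteq> C \<epsilon> l} \<le> card B"
      using finite_subset[OF B(1)] by (intro card_mono) (auto simp: C\<^sub>B_def)
    thus "real (card {l \<in> {1..n}. C\<^sub>B \<epsilon> l \<noteq> C \<epsilon> l}) \<le> \<phi> * real n" using B(2) by linarith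
  qed
  also have "\<dots> = (\<Sum>\<tau>\<in>?D. pmf A \<tau> * W \<tau>)"
    unfolding prob W_def by (subst sum.swap) (simp add: sum_distrib_left split_beta cong: if_cong)
  finally have le: "(1/2 + \<theta>) * 2 ^ m \<le> (\<Sum>\<tau>\<in>?D. pmf A \<tau> * W \<tau>)" .
  have "?D \<noteq> {}" using A set_pmf_not_empty[of A] by auto
  hence "Max (W ` ?D) \<in> W ` ?D" using fin by (intro Max_in) auto
  then obtain \<tau> where \<tau>: "\<tau> \<in> ?D" "W \<tau> = Max (W ` ?D)" by auto
  have tau: "\<tau> \<in> ?D" "\<And>\<tau>'. \<tau>' \<in> ?D \<Longrightarrow> W \<tau>' \<le> W \<tau>"
    using \<tau> fin by auto
  obtain i j k g where ijkg: "\<tau> = (i, j, k, g)" by (cases \<tau>)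
  have "(\<Sum>\<tau>'\<in>?D. pmf A \<tau>' * W \<tau>') \<le> (\<Sum>\<tau>'\<in>?D. pmf A \<tau>' * W \<tau>)"
    by (intro sum_mono mult_left_mono tau) auto
  also have "\<dots> = W \<tau>" using A fin by (simp add: sum_distrib_right[symmetric] sum_pmf_eq_1)
  finally have W: "(1/2 + \<theta>) * 2 ^ m \<le> W \<tau>" using le by simp
  have gval: "g (C\<^sub>B \<epsilon> i, C\<^sub>B \<epsilon> j, C\<^sub>B \<epsilon> k) \<in> {-1, 1}" if "\<epsilon> \<in> sign_vectors m" for \<epsilon>
  proof -
    have g: "g \<in> {-1, 1} \<times> {-1, 1} \<times> {-1, 1} \<rightarrow>\<^sub>E {-1, 1}" and ijk: "i \<in> {1..n}" "j \<in> {1..n}" "k \<in> {1..n}"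
      using tau(1) unfolding ijkg decoding_tuples_def by blast+
    have "C\<^sub>B \<epsilon> l \<in> {-1, 1}" if "l \<in> {1..n}" for l
      using sign_vectors_cases[OF C[OF \<open>\<epsilon> \<in> _\<close>] that] by (auto simp: C\<^sub>B_def)
    thus ?thesis using ijk by (intro PiE_mem[OF g]) blast
  qed
  have "2 * \<theta> * 2 ^ m \<le> 2 * W \<tau> - 2 ^ m" using W by (simp add: algebra_simps)
  also have "\<dots> = (\<Sum>\<epsilon>\<in>sign_vectors m. 2 * (if g (C\<^sub>B \<epsilon> i, C\<^sub>B \<epsilon> j, C\<^sub>B \<epsilon> k) = \<epsilon> t then 1 else 0) - 1)"
    by (simp add: W_def ijkg sum_subtractf sum_distrib_left card_sign_vectors)
  also have "\<dots> = (\<Sum>\<epsilon>\<in>sign_vectors m. \<epsilon> t * g (C\<^sub>B \<epsilon> i, C\<^sub>B \<epsilon> j, C\<^sub>B \<epsilon> k))"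
  proof (intro sum.cong refl)
    fix \<epsilon> assume e: "\<epsilon> \<in> sign_vectors m"
    show "2 * (if g (C\<^sub>B \<epsilon> i, C\<^sub>B \<epsilon> j, C\<^sub>B \<epsilon> k) = \<epsilon> t then 1 else 0) - 1 =
        \<epsilon> t * g (C\<^sub>B \<epsilon> i, C\<^sub>B \<epsilon> j, C\<^sub>B \<epsilon> k)"
      using gval[OF e] sign_vectors_cases[OF e t] by auto
  qed
  finally show ?thesis using that tau(1) ijkg by blast
qed

text \<open>With B overwritten, the decoder depends on at most three coordinates outside B, hence is
  a combination of at most 8 Walsh functions with coefficients of modulus at most 1. Correlation 2
  \<theta> forces one of them to reach 2 \<theta> / 8.\<close>

lemma decoding_walsh_coefficient:
  assumes code: "locally_decodable_code3 m n \<phi> \<theta> C" and t: "t \<in> {1..m}" and "0 < \<theta>"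
    and B: "B \<subseteq> {1..n}" "real (card B) \<le> \<phi> * real n"
  obtains Q where "Q \<subseteq> {1..n} - B" "Q \<noteq> {}" "card Q \<le> 3"
    and "\<theta> / 4 \<le> \<bar>walsh_coeff m (\<lambda>\<epsilon>. walsh Q (C \<epsilon>)) {t}\<bar>"
proof -
  define C\<^sub>B where "C\<^sub>B \<epsilon> l = (if l \<in> B then 1 else C \<epsilon> l)" for \<epsilon> l
  obtain i j k g where tup: "(i, j, k, g) \<in> decoding_tuples n"
    and corr: "2 * \<theta> * 2 ^ m \<le> (\<Sum>\<epsilon>\<in>sign_vectors m. \<epsilon> t * g (C\<^sub>B \<epsilon> i, C\<^sub>B \<epsilon> j, C\<^sub>B \<epsilon> k))"
    using decoding_correlation[OF code t B] unfolding C\<^sub>B_def by blast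
  have ijk: "i \<in> {1..n}" "j \<in> {1..n}" "k \<in> {1..n}"
    and g: "g \<in> {-1, 1} \<times> {-1, 1} \<times> {-1, 1} \<rightarrow>\<^sub>E {-1, 1}"
    using tup unfolding decoding_tuples_def by blast+
  have C: "C \<epsilon> \<in> sign_vectors n" if "\<epsilon> \<in> sign_vectors m" for \<epsilon>
    using code that unfolding locally_decodable_code3_def by auto
  define one where "one x l = (if l \<in> B then 1 else x l)" for x :: "nat \<Rightarrow> real" and l
  define h where "h x = g (one x i, one x j, one x k)" for x
  define R where "R = {i, j, k} - B"
  have R: "finite R" "R \<subseteq> {1..n} - B" "card R \<le> 3" "card (Pow R) \<le> 8"
  proof -
    show "finite R" "R \<subseteq> {1..n} - B" using ijk by (auto simp: R_def)
    have "card R \<le> card {i, j, k}" unfolding R_def by (intro card_mono) auto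
    also have "\<dots> \<le> 3" by (simp add: card_insert_if)
    finally show "card R \<le> 3" .
    hence "2 ^ card R \<le> (2 ^ 3 :: nat)" by (intro power_increasing) auto
    thus "card (Pow R) \<le> 8" by (simp add: card_Pow R_def)
  qed
  have hb: "\<bar>h x\<bar> \<le> 1" if "\<forall>i. x i \<in> {-1, 1}" for x
  proof -
    have "one x l \<in> {-1, 1}" for l using that by (simp add: one_def)
    hence "h x \<in> {-1, 1}" unfolding h_def by (intro PiE_mem[OF g]) blast
    thus ?thesis by auto
  qed
  have hR: "h x = h y" if "\<forall>i\<in>R. x i = y i" for x y
    using that by (auto simp: h_def one_def R_def)
  from walsh_decomposition[of R h, OF R(1) hb hR]
  obtain c where c: "\<And>S. \<bar>c S\<bar> \<le> 1" and hc: "\<And>x. \<forall>i. x i \<in> {-1, 1} \<Longrightarrow> h x = (\<Sum>S\<in>Pow R. c S * walsh S x)"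
    by blast
  have gc: "g (C\<^sub>B \<epsilon> i, C\<^sub>B \<epsilon> j, C\<^sub>B \<epsilon> k) = (\<Sum>S\<in>Pow R. c S * walsh S (C \<epsilon>))"
    if e: "\<epsilon> \<in> sign_vectors m" for \<epsilon>
  proof -
    \<comment> \<open>Codewords are \<open>undefined\<close> outside {1..n}. Putting 1 there gives
      the total sign function that the expansion requires and changes no queried coordinate.\<close>
    define x where "x l = (if l \<in> {1..n} then C \<epsilon> l else 1)" for l
    have "\<forall>l. x l \<in> {-1, 1}" using sign_vectors_cases[OF C[OF e]] by (auto simp: x_def)
    hence "h x = (\<Sum>S\<in>Pow R. c S * walsh S x)" by (rule hc)
    moreover have "h x = g (C\<^sub>B \<epsilon> i, C\<^sub>B \<epsilon> j, C\<^sub>B \<epsilon> k)"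
      using ijk by (simp add: h_def one_def C\<^sub>B_def x_def)
    moreover have "walsh S x = walsh S (C \<epsilon>)" if "S \<in> Pow R" for S
      unfolding walsh_def using that R(2) by (intro prod.cong) (auto simp: x_def)
    ultimately show ?thesis by simp
  qed
  define v where "v S = walsh_coeff m (\<lambda>\<epsilon>. walsh S (C \<epsilon>)) {t}" for S
  have "(\<Sum>\<epsilon>\<in>sign_vectors m. \<epsilon> t * g (C\<^sub>B \<epsilon> i, C\<^sub>B \<epsilon> j, C\<^sub>B \<epsilon> k)) =
      (\<Sum>\<epsilon>\<in>sign_vectors m. \<Sum>S\<in>Pow R. c S * (walsh S (C \<epsilon>) * walsh {t} \<epsilon>))"
    by (simp add: gc walsh_singleton sum_distrib_left mult_ac)
  also have "\<dots> = (\<Sum>S\<in>Pow R. c S * (2 ^ m * v S))"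
    by (subst sum.swap) (simp add: v_def walsh_coeff_def sum_distrib_left[symmetric])
  also have "\<dots> = 2 ^ m * (\<Sum>S\<in>Pow R. c S * v S)" by (simp add: sum_distrib_left mult_ac)
  finally have sum_ge: "2 * \<theta> \<le> (\<Sum>S\<in>Pow R. c S * v S)" using corr by (simp add: mult_ac)
  have "\<exists>S\<in>Pow R. \<theta> / 4 \<le> \<bar>v S\<bar>"
  proof (rule ccontr)
    assume "\<not> ?thesis"
    hence lt: "\<bar>v S\<bar> < \<theta> / 4" if "S \<in> Pow R" for S
      using that by (meson not_le)
    have "(\<Sum>S\<in>Pow R. c S * v S) \<le> (\<Sum>S\<in>Pow R. \<bar>v S\<bar>)"
    proof (intro sum_mono)
      fix S
      have "\<bar>c S\<bar> * \<bar>v S\<bar> \<le> 1 * \<bar>v S\<bar>" by (intro mult_right_mono c) auto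
      thus "c S * v S \<le> \<bar>v S\<bar>" using abs_ge_self[of "c S * v S"] by (simp add: abs_mult)
    qed
    also have "\<dots> < of_nat (card (Pow R)) * (\<theta> / 4)"
      using R(1) by (intro sum_bounded_above_strict lt) (auto simp: card_gt_0_iff)
    also have "\<dots> \<le> 8 * (\<theta> / 4)" using R(4) \<open>0 < \<theta>\<close> by (intro mult_right_mono) auto
    finally show False using sum_ge by simp
  qed
  then obtain S where S: "S \<subseteq> R" "\<theta> / 4 \<le> \<bar>v S\<bar>" by blast
  \<comment> \<open>The constant Walsh function is orthogonal to the bit t, so the large coefficient
    belongs to a nonempty set.\<close>
  have "v {} = 0"
    using walsh_orthonormal[of "{}" m "{t}"] t by (simp add: v_def walsh_coeff_def walsh_def)
  hence "S \<noteq> {}" using S(2) \<open>0 < \<theta>\<close> by auto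
  moreover have "card S \<le> 3" using card_mono[OF R(1) S(1)] R(3) by simp
  ultimately show ?thesis using that S R(2) unfolding v_def by blast
qed

text \<open>Greedy choice: the union of the sets found so far has at most three elements per set and
  is overwritten, so the next set avoids it. The bound involves r - 1 because only the sets before
  the last one are overwritten.\<close>

lemma disjoint_decoding_sets:
  assumes code: "locally_decodable_code3 m n \<phi> \<theta> C" and t: "t \<in> {1..m}" and "0 < \<theta>"
    and "r = 0 \<or> 3 * (real r - 1) \<le> \<phi> * real n"
  shows "\<exists>Q :: nat \<Rightarrow> nat set. disjoint_family_on Q {1..r} \<and>
    (\<forall>s\<in>{1..r}. Q s \<subseteq> {1..n} \<and> Q s \<noteq> {} \<and> card (Q s) \<le> 3 \<and>
       \<theta> / 4 \<le> \<bar>walsh_coeff m (\<lambda>\<epsilon>. walsh (Q s) (C \<epsilon>)) {t}\<bar>)"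
  using assms(4)
proof (induction r)
  case 0
  show ?case by (auto simp: disjoint_family_on_def)
next
  case (Suc r)
  have "r = 0 \<or> 3 * (real r - 1) \<le> \<phi> * real n" using Suc.prems by auto
  then obtain Q :: "nat \<Rightarrow> nat set" where disj: "disjoint_family_on Q {1..r}"
    and Q: "\<And>s. s \<in> {1..r} \<Longrightarrow> Q s \<subseteq> {1..n} \<and> Q s \<noteq> {} \<and> card (Q s) \<le> 3 \<and>
       \<theta> / 4 \<le> \<bar>walsh_coeff m (\<lambda>\<epsilon>. walsh (Q s) (C \<epsilon>)) {t}\<bar>"
    using Suc.IH by blast
  define B where "B = (\<Union>s\<in>{1..r}. Q s)"
  have "card B \<le> (\<Sum>s\<in>{1..r}. card (Q s))" unfolding B_def by (rule card_UN_le) simp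
  also have "\<dots> \<le> (\<Sum>s\<in>{1..r}. 3)" using Q by (intro sum_mono) auto
  finally have "real (card B) \<le> 3 * real r" by simp
  also have "\<dots> \<le> \<phi> * real n" using Suc.prems by simp
  finally have B: "real (card B) \<le> \<phi> * real n" .
  have "B \<subseteq> {1..n}" using Q unfolding B_def by blast
  from decoding_walsh_coefficient[OF code t \<open>0 < \<theta>\<close> this B]
  obtain P where P: "P \<subseteq> {1..n} - B" "P \<noteq> {}" "card P \<le> 3"
    "\<theta> / 4 \<le> \<bar>walsh_coeff m (\<lambda>\<epsilon>. walsh P (C \<epsilon>)) {t}\<bar>" by blast
  have "disjoint_family_on (Q(Suc r := P)) {1..Suc r}"
    using disj P(1) unfolding disjoint_family_on_def B_def
    by (auto simp: atLeastAtMostSuc_conv)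
  moreover have "\<forall>s\<in>{1..Suc r}. (Q(Suc r := P)) s \<subseteq> {1..n} \<and> (Q(Suc r := P)) s \<noteq> {} \<and> card ((Q(Suc r := P)) s) \<le> 3 \<and>
       \<theta> / 4 \<le> \<bar>walsh_coeff m (\<lambda>\<epsilon>. walsh ((Q(Suc r := P)) s) (C \<epsilon>)) {t}\<bar>"
    using Q P by (auto simp: atLeastAtMostSuc_conv)
  ultimately show ?case by blast
qed

section \<open>Placing the query sets on a generalised diagonal\<close>

lemma inj_on_extends_to_permutation:
  assumes "finite A" "B \<subseteq> A" "inj_on f B" "f ` B \<subseteq> A"
  obtains \<pi> where "\<pi> permutes A" "\<And>x. x \<in> B \<Longrightarrow> \<pi> x = f x"
proof -
  have "card (A - B) = card (A - f ` B)"
    using assms by (simp add: card_Diff_subset finite_subset card_image)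
  then obtain g where g: "bij_betw g (A - B) (A - f ` B)"
    using assms(1) by (meson finite_Diff finite_same_card_bij)
  define \<pi> where "\<pi> x = (if x \<in> B then f x else if x \<in> A then g x else x)" for x
  have "bij_betw \<pi> (B \<union> (A - B)) (f ` B \<union> (A - f ` B))"
  proof (rule bij_betw_combine)
    show "bij_betw \<pi> B (f ` B)"
      using bij_betw_cong[of B \<pi> f] assms(3) by (simp add: \<pi>_def inj_on_imp_bij_betw)
    show "bij_betw \<pi> (A - B) (A - f ` B)"
      using bij_betw_cong[of "A - B" \<pi> g] g by (simp add: \<pi>_def)
  qed auto
  moreover have "B \<union> (A - B) = A" "f ` B \<union> (A - f ` B) = A" using assms by auto
  ultimately have "\<pi> permutes A"
    using assms(2) by (intro bij_imp_permutes) (auto simp: \<pi>_def)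
  thus ?thesis using that by (auto simp: \<pi>_def)
qed

text \<open>The ones supply neutral factors, which let products of one or two code coordinates
  appear as entries of the threefold tensor power.\<close>

definition pad_one :: "nat \<Rightarrow> (nat \<Rightarrow> real) \<Rightarrow> nat \<Rightarrow> real" where
  "pad_one n x l = (if l \<in> {1..n} then x l else 1)"

text \<open>Missing factors are filled by an index n + a with a in Q, where the padded word is 1.
  Tying the fillers to Q keeps the triples of disjoint query sets disjoint.\<close>

lemma walsh_as_padded_triple:
  assumes "Q \<subseteq> {1..n}" "Q \<noteq> {}" "card Q \<le> 3"
  obtains i j k where "i \<in> Q \<union> (+) n ` Q" "j \<in> Q \<union> (+) n ` Q" "k \<in> Q \<union> (+) n ` Q"
    and "\<And>x. walsh Q x = pad_one n x i * pad_one n x j * pad_one n x k"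
proof -
  have pad: "pad_one n x a = x a" "pad_one n x (n + a) = 1" if "a \<in> Q" for x a
    using that assms(1) by (auto simp: pad_one_def)
  have "finite Q" using assms(1) finite_subset by blast
  hence "card Q \<noteq> 0" using assms(2) by simp
  with assms(3) consider "card Q = 1" | "card Q = 2" | "card Q = 3" by linarith
  thus ?thesis
  proof cases
    case 1
    then obtain a where "Q = {a}" by (rule card_1_singletonE)
    thus ?thesis using pad by (intro that[of a "n + a" "n + a"]) (auto simp: walsh_def)
  next
    case 2
    then obtain a b where "Q = {a, b}" "a \<noteq> b" by (auto simp: card_2_iff)
    thus ?thesis using pad by (intro that[of a b "n + a"]) (auto simp: walsh_def)
  next
    case 3
    then obtain a b c where "Q = {a, b, c}" "a \<noteq> b" "b \<noteq> c" "a \<noteq> c" by (auto simp: card_3_iff)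
    thus ?thesis using pad by (intro that[of a b c]) (auto simp: walsh_def)
  qed
qed

text \<open>Triples of disjoint query sets share no index, so each of the three index maps is
  injective and extends to a permutation. The large coefficients then sit on a single generalised
  diagonal.\<close>

lemma decodable_diagonal:
  assumes code: "locally_decodable_code3 m n \<phi> \<theta> C" and t: "t \<in> {1..m}" and "0 < \<theta>" "0 < \<phi>"
  obtains \<pi> \<sigma> \<tau> r where "\<pi> permutes {1..3*n}" "\<sigma> permutes {1..3*n}" "\<tau> permutes {1..3*n}"
    and "r \<le> 3 * n" "\<phi> * real n / 3 \<le> real r"
    and "\<And>s. s \<in> {1..r} \<Longrightarrow> \<theta> / 4 \<le>
      \<bar>walsh_coeff m (\<lambda>\<epsilon>. pad_one n (C \<epsilon>) (\<pi> s) * pad_one n (C \<epsilon>) (\<sigma> s) * pad_one n (C \<epsilon>) (\<tau> s)) {t}\<bar>"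
proof -
  define y where "y = \<phi> * real n / 3"
  \<comment> \<open>One more than the floor gives r >= \<phi> n / 3 and still 3 (r - 1) <= \<phi> n,
    as the greedy choice demands.\<close>
  define r where "r = nat \<lfloor>y\<rfloor> + 1"
  have "0 \<le> y" using \<open>0 < \<phi>\<close> by (simp add: y_def)
  hence "real r = of_int \<lfloor>y\<rfloor> + 1" by (simp add: r_def)
  hence "y \<le> real r" "real r - 1 \<le> y"
    using of_int_floor_le[of y] real_of_int_floor_add_one_ge[of y] by simp_all
  hence r: "\<phi> * real n / 3 \<le> real r" "3 * (real r - 1) \<le> \<phi> * real n" by (simp_all add: y_def)
  obtain Q :: "nat \<Rightarrow> nat set" where disj: "disjoint_family_on Q {1..r}"
    and Q: "\<And>s. s \<in> {1..r} \<Longrightarrow> Q s \<subseteq> {1..n} \<and> Q s \<noteq> {} \<and> card (Q s) \<le> 3 \<and>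
       \<theta> / 4 \<le> \<bar>walsh_coeff m (\<lambda>\<epsilon>. walsh (Q s) (C \<epsilon>)) {t}\<bar>"
    using disjoint_decoding_sets[OF code t \<open>0 < \<theta>\<close>, of r] r(2) by blast
  have "\<exists>v. (\<forall>l\<in>{fst v, fst (snd v), snd (snd v)}. l \<in> Q s \<union> (+) n ` Q s) \<and>
      (\<forall>x. walsh (Q s) x = pad_one n x (fst v) * pad_one n x (fst (snd v)) * pad_one n x (snd (snd v)))"
    if s: "s \<in> {1..r}" for s
  proof -
    obtain i j k where "i \<in> Q s \<union> (+) n ` Q s" "j \<in> Q s \<union> (+) n ` Q s" "k \<in> Q s \<union> (+) n ` Q s"
      and "\<And>x. walsh (Q s) x = pad_one n x i * pad_one n x j * pad_one n x k"
      using walsh_as_padded_triple[of "Q s" n] Q[OF s] by blast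
    thus ?thesis by (intro exI[of _ "(i, j, k)"] conjI ballI allI) (auto simp only: fst_conv snd_conv insert_iff empty_iff)
  qed
  hence "\<exists>v. \<forall>s\<in>{1..r}. (\<forall>l\<in>{fst (v s), fst (snd (v s)), snd (snd (v s))}. l \<in> Q s \<union> (+) n ` Q s) \<and>
      (\<forall>x. walsh (Q s) x = pad_one n x (fst (v s)) * pad_one n x (fst (snd (v s))) * pad_one n x (snd (snd (v s))))"
    by (intro bchoice ballI)
  then obtain v where v: "\<And>s. s \<in> {1..r} \<Longrightarrow> \<forall>l\<in>{fst (v s), fst (snd (v s)), snd (snd (v s))}. l \<in> Q s \<union> (+) n ` Q s"
    and walsh: "\<And>s x. s \<in> {1..r} \<Longrightarrow>
      walsh (Q s) x = pad_one n x (fst (v s)) * pad_one n x (fst (snd (v s))) * pad_one n x (snd (snd (v s)))"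
    by blast
  have inj: "inj_on f {1..r}" and im: "f ` {1..r} \<subseteq> {1..3*n}"
    if f: "\<And>s. s \<in> {1..r} \<Longrightarrow> f s \<in> Q s \<union> (+) n ` Q s" for f
  proof -
    \<comment> \<open>Reducing an index above n by n recovers an element of the query set, so a
      repeated value of f would give a common element of two disjoint sets.\<close>
    have f': "f s - n * of_bool (f s > n) \<in> Q s" "Q s \<subseteq> {1..n}" if "s \<in> {1..r}" for s
      using f[OF that] Q[OF that] by (auto simp: subset_iff)
    show "inj_on f {1..r}"
    proof (rule inj_onI, rule ccontr)
      fix s s' assume s: "s \<in> {1..r}" "s' \<in> {1..r}" "f s = f s'" "s \<noteq> s'"
      hence "Q s \<inter> Q s' = {}" using disj unfolding disjoint_family_on_def by blast
      thus False using f'(1)[OF s(1)] f'(1)[OF s(2)] s(3) by auto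
    qed
    show "f ` {1..r} \<subseteq> {1..3*n}"
    proof
      fix y assume "y \<in> f ` {1..r}"
      then obtain s where s: "s \<in> {1..r}" "y = f s" by blast
      have "f s - n * of_bool (f s > n) \<in> {1..n}" using f'[OF s(1)] by blast
      thus "y \<in> {1..3*n}" using s(2) by (auto split: if_splits simp: of_bool_def)
    qed
  qed
  have "card {1..r} \<le> card {1..3*n}"
    by (rule card_inj_on_le[OF inj im, of "\<lambda>s. fst (v s)"]) (use v in auto)
  hence rn: "r \<le> 3 * n" by simp
  have ext: "\<exists>\<pi>. \<pi> permutes {1..3*n} \<and> (\<forall>s\<in>{1..r}. \<pi> s = f s)"
    if f: "\<And>s. s \<in> {1..r} \<Longrightarrow> f s \<in> Q s \<union> (+) n ` Q s" for f
  proof -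
    have "{1..r} \<subseteq> {1..3*n}" using rn by auto
    then obtain \<pi> where "\<pi> permutes {1..3*n}" "\<And>s. s \<in> {1..r} \<Longrightarrow> \<pi> s = f s"
      using inj_on_extends_to_permutation[OF finite_atLeastAtMost _ inj[of f, OF f] im[of f, OF f]] by blast
    thus ?thesis by blast
  qed
  obtain \<pi> \<sigma> \<tau> where perm: "\<pi> permutes {1..3*n}" "\<sigma> permutes {1..3*n}" "\<tau> permutes {1..3*n}"
    and eq: "\<And>s. s \<in> {1..r} \<Longrightarrow> \<pi> s = fst (v s)" "\<And>s. s \<in> {1..r} \<Longrightarrow> \<sigma> s = fst (snd (v s))"
      "\<And>s. s \<in> {1..r} \<Longrightarrow> \<tau> s = snd (snd (v s))"
  proof -
    have "\<exists>\<pi>. \<pi> permutes {1..3*n} \<and> (\<forall>s\<in>{1..r}. \<pi> s = fst (v s))"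
      "\<exists>\<pi>. \<pi> permutes {1..3*n} \<and> (\<forall>s\<in>{1..r}. \<pi> s = fst (snd (v s)))"
      "\<exists>\<pi>. \<pi> permutes {1..3*n} \<and> (\<forall>s\<in>{1..r}. \<pi> s = snd (snd (v s)))"
      by (rule ext, use v in blast)+
    thus ?thesis using that by blast
  qed
  show ?thesis
    by (rule that[OF perm rn r(1)]) (use Q in \<open>simp add: eq walsh[symmetric]\<close>)
qed

section \<open>Tensor-symmetric norms\<close>

lemma lookup_scaleR: "Poly_Mapping.lookup (c *\<^sub>R x) i = c * Poly_Mapping.lookup x i"
proof -
  have "finite {i. c * Poly_Mapping.lookup x i \<noteq> 0}"
    by (rule finite_subset[OF _ finite_lookup[of x]]) auto
  thus ?thesis by (simp add: scaleR_poly_mapping_def Abs_poly_mapping_inverse)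
qed

text \<open>The triple sum has the shape in which \<open>tensor_symmetric\<close> states its
  inequality; values of \<open>a\<close> outside {1..N} do not enter.\<close>

definition tensor_of :: "nat \<Rightarrow> (nat \<Rightarrow> nat \<Rightarrow> nat \<Rightarrow> real) \<Rightarrow> tensor3" where
  "tensor_of N a = (\<Sum>i=1..N. \<Sum>j=1..N. \<Sum>k=1..N. a i j k *\<^sub>R e3 i j k)"

lemma lookup_tensor_of:
  "Poly_Mapping.lookup (tensor_of N a) (i, j, k) =
     (if i \<in> {1..N} \<and> j \<in> {1..N} \<and> k \<in> {1..N} then a i j k else 0)"
proof -
  have "Poly_Mapping.lookup (tensor_of N a) (i, j, k) =
      (\<Sum>i'=1..N. \<Sum>j'=1..N. \<Sum>k'=1..N. if k' = k then (if j' = j then if i' = i then a i j k else 0 else 0) else 0)"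
    unfolding tensor_of_def lookup_sum lookup_scaleR e3_def
    by (intro sum.cong refl) (auto simp: lookup_single when_def)
  also have "\<dots> = (if i \<in> {1..N} \<and> j \<in> {1..N} \<and> k \<in> {1..N} then a i j k else 0)"
    by (cases "i \<in> {1..N}"; cases "j \<in> {1..N}"; cases "k \<in> {1..N}")
       (simp_all only: sum.delta finite_atLeastAtMost if_True if_False simp_thms sum.neutral_const if_cancel)
  finally show ?thesis .
qed

lemma tensor_of_in_space: "tensor_of N a \<in> tensor_space N"
  unfolding tensor_space_def by (auto simp: in_keys_iff lookup_tensor_of split: if_splits)

lemma tensor_of_lookup:
  assumes "x \<in> tensor_space N"
  shows "x = tensor_of N (\<lambda>i j k. Poly_Mapping.lookup x (i, j, k))"
proof (rule poly_mapping_eqI)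
  fix t :: "nat \<times> nat \<times> nat"
  obtain i j k where "t = (i, j, k)" by (cases t)
  thus "Poly_Mapping.lookup x t = Poly_Mapping.lookup (tensor_of N (\<lambda>i j k. Poly_Mapping.lookup x (i, j, k))) t"
    using assms unfolding tensor_space_def by (auto simp: lookup_tensor_of in_keys_iff subset_iff)
qed

lemma tensor_of_eq_iff:
  "tensor_of N a = tensor_of N b \<longleftrightarrow> (\<forall>i\<in>{1..N}. \<forall>j\<in>{1..N}. \<forall>k\<in>{1..N}. a i j k = b i j k)"
proof
  assume eq: "tensor_of N a = tensor_of N b"
  show "\<forall>i\<in>{1..N}. \<forall>j\<in>{1..N}. \<forall>k\<in>{1..N}. a i j k = b i j k"
  proof (intro ballI)
    fix i j k assume "i \<in> {1..N}" "j \<in> {1..N}" "k \<in> {1..N}"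
    thus "a i j k = b i j k"
      using lookup_tensor_of[of N a i j k] lookup_tensor_of[of N b i j k] eq by simp
  qed
next
  assume "\<forall>i\<in>{1..N}. \<forall>j\<in>{1..N}. \<forall>k\<in>{1..N}. a i j k = b i j k"
  thus "tensor_of N a = tensor_of N b" unfolding tensor_of_def by (intro sum.cong refl) auto
qed

lemma tensor_of_sum:
  "tensor_of N (\<lambda>i j k. \<Sum>s\<in>S. c s * a s i j k) = (\<Sum>s\<in>S. c s *\<^sub>R tensor_of N (a s))"
proof (rule poly_mapping_eqI)
  fix t :: "nat \<times> nat \<times> nat"
  obtain i j k where "t = (i, j, k)" by (cases t)
  thus "Poly_Mapping.lookup (tensor_of N (\<lambda>i j k. \<Sum>s\<in>S. c s * a s i j k)) t =
      Poly_Mapping.lookup (\<Sum>s\<in>S. c s *\<^sub>R tensor_of N (a s)) t"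
    by (auto simp: lookup_sum lookup_scaleR lookup_tensor_of)
qed

lemma tensor_of_diag: "(\<Sum>i=1..N. e3 i i i) = tensor_of N (\<lambda>i j k. if i = j \<and> j = k then 1 else 0)"
proof (rule poly_mapping_eqI)
  fix t :: "nat \<times> nat \<times> nat"
  obtain i j k where t: "t = (i, j, k)" by (cases t)
  have "Poly_Mapping.lookup (\<Sum>i=1..N. e3 i i i) (i, j, k) =
      (\<Sum>l=1..N. if l = i then (if i = j \<and> j = k then 1 else 0) else 0)"
    unfolding lookup_sum e3_def by (intro sum.cong refl) (auto simp: lookup_single when_def)
  thus "Poly_Mapping.lookup (\<Sum>i=1..N. e3 i i i) t =
      Poly_Mapping.lookup (tensor_of N (\<lambda>i j k. if i = j \<and> j = k then 1 else 0)) t"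
    unfolding t lookup_tensor_of by (auto simp: sum.delta)
qed

lemma tensor_of_ones: "(\<Sum>i=1..N. \<Sum>j=1..N. \<Sum>k=1..N. e3 i j k) = tensor_of N (\<lambda>i j k. 1)"
  by (simp add: tensor_of_def)

section \<open>Averages over permutations and signs\<close>

lemma sum_over_permutations:
  fixes b :: "'a \<Rightarrow> real"
  assumes "finite A" "i \<in> A"
  shows "real (card A) * (\<Sum>\<rho>\<in>{\<rho>. \<rho> permutes A}. b (\<rho> i)) = real (card {\<rho>. \<rho> permutes A}) * sum b A"
proof -
  \<comment> \<open>Composing with the transposition of i and j permutes the group, so the sum is
    the same for every index and equals its average over all indices.\<close>
  have eq: "(\<Sum>\<rho>\<in>{\<rho>. \<rho> permutes A}. b (\<rho> j)) = (\<Sum>\<rho>\<in>{\<rho>. \<rho> permutes A}. b (\<rho> i))" if "j \<in> A" for j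
    using sum_permutations_compose_right[OF permutes_swap_id[OF assms(2) that], of "\<lambda>\<rho>. b (\<rho> j)"]
    by simp
  have "real (card A) * (\<Sum>\<rho>\<in>{\<rho>. \<rho> permutes A}. b (\<rho> i)) = (\<Sum>j\<in>A. \<Sum>\<rho>\<in>{\<rho>. \<rho> permutes A}. b (\<rho> j))"
    by (simp add: eq)
  also have "\<dots> = (\<Sum>\<rho>\<in>{\<rho>. \<rho> permutes A}. \<Sum>j\<in>A. b (\<rho> j))" by (rule sum.swap)
  also have "\<dots> = (\<Sum>\<rho>\<in>{\<rho>. \<rho> permutes A}. sum b A)"
  proof (rule sum.cong[OF refl])
    fix \<rho> assume "\<rho> \<in> {\<rho>. \<rho> permutes A}"
    hence "bij_betw \<rho> A A" by (auto intro: permutes_imp_bij)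
    thus "(\<Sum>j\<in>A. b (\<rho> j)) = sum b A" by (rule sum.reindex_bij_betw)
  qed
  finally show ?thesis by simp
qed

lemma sum_sign_vectors_mult:
  assumes "i \<in> {1..N}" "j \<in> {1..N}"
  shows "(\<Sum>\<epsilon>\<in>sign_vectors N. \<epsilon> i * \<epsilon> j) = (if i = j then 2 ^ N else 0)"
  using walsh_orthonormal[of "{i}" N "{j}"] assms by (simp add: walsh_singleton)

lemma expectation_sign_vectors:
  fixes f :: "(nat \<Rightarrow> real) \<Rightarrow> real"
  shows "measure_pmf.expectation (pmf_of_set (sign_vectors N)) f = (\<Sum>\<epsilon>\<in>sign_vectors N. f \<epsilon>) / 2 ^ N"
  by (simp add: integral_pmf_of_set sign_vectors_nonempty finite_sign_vectors card_sign_vectors)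

text \<open>Unlike \<open>sign_vectors\<close> this prescribes nothing outside the index range, so
  it is stable under products and under composition with permutations.\<close>

definition is_sign_on :: "nat \<Rightarrow> (nat \<Rightarrow> real) \<Rightarrow> bool" where
  "is_sign_on N \<epsilon> \<longleftrightarrow> (\<forall>i\<in>{1..N}. \<epsilon> i = 1 \<or> \<epsilon> i = -1)"

lemma is_sign_on_simps [simp]:
  "is_sign_on N (\<lambda>_. 1)"
  "\<epsilon> \<in> sign_vectors N \<Longrightarrow> is_sign_on N \<epsilon>"
  "\<epsilon> \<in> sign_vectors N \<Longrightarrow> i0 \<in> {1..N} \<Longrightarrow> is_sign_on N (\<lambda>i. \<epsilon> i0 * \<epsilon> i)"
proof -
  show "is_sign_on N (\<lambda>_. 1)" by (simp add: is_sign_on_def)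
  show "is_sign_on N \<epsilon>" if "\<epsilon> \<in> sign_vectors N" for \<epsilon>
    using sign_vectors_cases[OF that] by (simp add: is_sign_on_def)
  show "is_sign_on N (\<lambda>i. \<epsilon> i0 * \<epsilon> i)" if "\<epsilon> \<in> sign_vectors N" "i0 \<in> {1..N}" for \<epsilon> i0
    unfolding is_sign_on_def
  proof
    fix i assume "i \<in> {1..N}"
    from sign_vectors_cases[OF that] sign_vectors_cases[OF that(1) this]
    show "\<epsilon> i0 * \<epsilon> i = 1 \<or> \<epsilon> i0 * \<epsilon> i = -1" by (elim disjE) simp_all
  qed
qed

section \<open>The norm of coordinate arrays and its averages\<close>

locale tensor_symmetric_norm =
  fixes N :: nat and K :: real and p :: "tensor3 \<Rightarrow> real"
  assumes norm: "is_norm_on (tensor_space N) p" and K: "1 \<le> K" and sym: "tensor_symmetric N K p"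
begin

definition P :: "(nat \<Rightarrow> nat \<Rightarrow> nat \<Rightarrow> real) \<Rightarrow> real" where
  "P a = p (tensor_of N a)"

lemma norm_facts:
  shows "subspace (tensor_space N)"
    and "\<And>x. x \<in> tensor_space N \<Longrightarrow> 0 \<le> p x"
    and "\<And>x. x \<in> tensor_space N \<Longrightarrow> p x = 0 \<longleftrightarrow> x = 0"
    and "\<And>c x. x \<in> tensor_space N \<Longrightarrow> p (c *\<^sub>R x) = \<bar>c\<bar> * p x"
    and "\<And>x y. x \<in> tensor_space N \<Longrightarrow> y \<in> tensor_space N \<Longrightarrow> p (x + y) \<le> p x + p y"
  using norm unfolding is_norm_on_def by simp_all

lemma P_nonneg: "0 \<le> P a"
  unfolding P_def by (rule norm_facts(2)[OF tensor_of_in_space])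

lemma P_cong:
  assumes "\<And>i j k. i \<in> {1..N} \<Longrightarrow> j \<in> {1..N} \<Longrightarrow> k \<in> {1..N} \<Longrightarrow> a i j k = b i j k"
  shows "P a = P b"
proof -
  have "tensor_of N a = tensor_of N b" unfolding tensor_of_eq_iff using assms by blast
  thus ?thesis by (simp add: P_def)
qed

lemma P_sum_le:
  assumes "finite S"
  shows "P (\<lambda>i j k. \<Sum>s\<in>S. c s * a s i j k) \<le> (\<Sum>s\<in>S. \<bar>c s\<bar> * P (a s))"
proof -
  have zero: "p 0 = 0" using norm_facts(3) subspace_0[OF norm_facts(1)] by blast
  have "p (\<Sum>s\<in>S. c s *\<^sub>R tensor_of N (a s)) \<le> (\<Sum>s\<in>S. \<bar>c s\<bar> * p (tensor_of N (a s)))"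
    using assms
  proof (induction S rule: finite_induct)
    case (insert s S)
    have "p (\<Sum>s\<in>insert s S. c s *\<^sub>R tensor_of N (a s)) \<le>
        p (c s *\<^sub>R tensor_of N (a s)) + p (\<Sum>s\<in>S. c s *\<^sub>R tensor_of N (a s))"
      unfolding sum.insert[OF insert.hyps]
      by (intro norm_facts(5) subspace_scale subspace_sum norm_facts(1) tensor_of_in_space)
    thus ?case using insert by (simp add: norm_facts(4)[OF tensor_of_in_space])
  qed (simp add: zero)
  thus ?thesis by (simp add: P_def tensor_of_sum)
qed

lemma P_scale: "P (\<lambda>i j k. c * a i j k) = \<bar>c\<bar> * P a"
proof -
  have "tensor_of N (\<lambda>i j k. c * a i j k) = c *\<^sub>R tensor_of N a"
    using tensor_of_sum[where S = "{()}" and c = "\<lambda>_. c" and a = "\<lambda>_. a"] by simp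
  thus ?thesis unfolding P_def by (simp only: norm_facts(4)[OF tensor_of_in_space])
qed

lemma P_add_le: "P (\<lambda>i j k. a i j k + b i j k) \<le> P a + P b"
  using P_sum_le[of "UNIV :: bool set" "\<lambda>_. 1" "\<lambda>s. if s then a else b"] by (simp add: UNIV_bool add.commute)

lemma P_pos:
  assumes "i \<in> {1..N}" "j \<in> {1..N}" "k \<in> {1..N}" "a i j k \<noteq> 0"
  shows "0 < P a"
proof -
  have "tensor_of N a \<noteq> 0" using lookup_tensor_of[of N a i j k] assms by auto
  hence "P a \<noteq> 0" unfolding P_def by (simp only: norm_facts(3)[OF tensor_of_in_space] not_False_eq_True)
  thus ?thesis using P_nonneg[of a] by simp
qed

text \<open>The bound M holds on the whole orbit of a under signs and permutations. This property is
  inherited by averages over the group, so repeated averaging costs a single factor K in total.\<close>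

definition orbit_bound :: "real \<Rightarrow> (nat \<Rightarrow> nat \<Rightarrow> nat \<Rightarrow> real) \<Rightarrow> bool" where
  "orbit_bound M a \<longleftrightarrow> (\<forall>\<pi> \<sigma> \<tau> \<epsilon> \<delta> \<eta>.
     \<pi> permutes {1..N} \<longrightarrow> \<sigma> permutes {1..N} \<longrightarrow> \<tau> permutes {1..N} \<longrightarrow>
     is_sign_on N \<epsilon> \<longrightarrow> is_sign_on N \<delta> \<longrightarrow> is_sign_on N \<eta> \<longrightarrow>
     P (\<lambda>i j k. \<epsilon> i * \<delta> j * \<eta> k * a (\<pi> i) (\<sigma> j) (\<tau> k)) \<le> M)"

text \<open>Here tensor symmetry enters, and with it the factor K; the averaging below keeps the
  constant.\<close>

lemma orbit_bound_self: "orbit_bound (K * P a) a"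
  unfolding orbit_bound_def
proof (intro allI impI)
  fix \<pi> \<sigma> \<tau> \<epsilon> \<delta> \<eta>
  assume perm: "\<pi> permutes {1..N}" "\<sigma> permutes {1..N}" "\<tau> permutes {1..N}"
    and sgn: "is_sign_on N \<epsilon>" "is_sign_on N \<delta>" "is_sign_on N \<eta>"
  have r: "restrict \<zeta> {1..N} \<in> sign_vectors N" if "is_sign_on N \<zeta>" for \<zeta>
    using that unfolding sign_vectors_def is_sign_on_def by auto
  have "P (\<lambda>i j k. \<epsilon> i * \<delta> j * \<eta> k * a (\<pi> i) (\<sigma> j) (\<tau> k)) =
      P (\<lambda>i j k. restrict \<epsilon> {1..N} i * restrict \<delta> {1..N} j * restrict \<eta> {1..N} k * a (\<pi> i) (\<sigma> j) (\<tau> k))"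
    by (rule P_cong) simp
  also have "\<dots> \<le> K * P a"
    unfolding P_def tensor_of_def
    by (rule sym[unfolded tensor_symmetric_def, THEN spec, THEN spec, THEN spec, THEN mp,
          OF conjI[OF perm(1) conjI[OF perm(2,3)]], THEN bspec, OF r[OF sgn(1)],
          THEN bspec, OF r[OF sgn(2)], THEN bspec, OF r[OF sgn(3)], THEN spec, of a])
  finally show "P (\<lambda>i j k. \<epsilon> i * \<delta> j * \<eta> k * a (\<pi> i) (\<sigma> j) (\<tau> k)) \<le> K * P a" .
qed

lemma orbit_boundD: "orbit_bound M a \<Longrightarrow> P a \<le> M"
proof -
  assume "orbit_bound M a"
  hence "P (\<lambda>i j k. 1 * 1 * 1 * a (id i) (id j) (id k)) \<le> M"
    by (rule orbit_bound_def[THEN iffD1, rule_format, OF _ permutes_id permutes_id permutes_id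
          is_sign_on_simps(1) is_sign_on_simps(1) is_sign_on_simps(1)])
  thus "P a \<le> M" by simp
qed

lemma orbit_bound_cong:
  assumes "orbit_bound M a"
    and "\<And>i j k. i \<in> {1..N} \<Longrightarrow> j \<in> {1..N} \<Longrightarrow> k \<in> {1..N} \<Longrightarrow> a i j k = b i j k"
  shows "orbit_bound M b"
  unfolding orbit_bound_def
proof (intro allI impI)
  fix \<pi> \<sigma> \<tau> \<epsilon> \<delta> \<eta>
  assume perm: "\<pi> permutes {1..N}" "\<sigma> permutes {1..N}" "\<tau> permutes {1..N}"
    and sgn: "is_sign_on N \<epsilon>" "is_sign_on N \<delta>" "is_sign_on N \<eta>"
  have "P (\<lambda>i j k. \<epsilon> i * \<delta> j * \<eta> k * b (\<pi> i) (\<sigma> j) (\<tau> k)) = P (\<lambda>i j k. \<epsilon> i * \<delta> j * \<eta> k * a (\<pi> i) (\<sigma> j) (\<tau> k))"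
    by (rule P_cong) (simp only: assms(2) permutes_in_image[OF perm(1)] permutes_in_image[OF perm(2)] permutes_in_image[OF perm(3)])
  thus "P (\<lambda>i j k. \<epsilon> i * \<delta> j * \<eta> k * b (\<pi> i) (\<sigma> j) (\<tau> k)) \<le> M"
    using assms(1)[unfolded orbit_bound_def, rule_format, OF perm sgn] by simp
qed

text \<open>Signed permutations form a group: two successive actions amount to one with permutation
  \<open>\<pi> \<circ> \<pi>'\<close> and signs
  \<open>\<epsilon>' i * \<epsilon> (\<pi>' i)\<close>, and likewise in the other two indices. The
  orbit stays the same.\<close>

lemma orbit_bound_action:
  assumes "orbit_bound M a" and perm: "\<pi> permutes {1..N}" "\<sigma> permutes {1..N}" "\<tau> permutes {1..N}"
    and sgn: "is_sign_on N \<epsilon>" "is_sign_on N \<delta>" "is_sign_on N \<eta>"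
  shows "orbit_bound M (\<lambda>i j k. \<epsilon> i * \<delta> j * \<eta> k * a (\<pi> i) (\<sigma> j) (\<tau> k))"
  unfolding orbit_bound_def
proof (intro allI impI)
  fix \<pi>' \<sigma>' \<tau>' \<epsilon>' \<delta>' \<eta>'
  assume perm': "\<pi>' permutes {1..N}" "\<sigma>' permutes {1..N}" "\<tau>' permutes {1..N}"
    and sgn': "is_sign_on N \<epsilon>'" "is_sign_on N \<delta>'" "is_sign_on N \<eta>'"
  have comp: "is_sign_on N (\<lambda>i. \<zeta>' i * \<zeta> (\<rho> i))"
    if "is_sign_on N \<zeta>'" "is_sign_on N \<zeta>" "\<rho> permutes {1..N}" for \<zeta> \<zeta>' \<rho>
    unfolding is_sign_on_def
  proof
    fix i assume i: "i \<in> {1..N}"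
    hence "\<rho> i \<in> {1..N}" using permutes_in_image[OF that(3)] by blast
    thus "\<zeta>' i * \<zeta> (\<rho> i) = 1 \<or> \<zeta>' i * \<zeta> (\<rho> i) = -1"
      using that i unfolding is_sign_on_def by fastforce
  qed
  have "P (\<lambda>i j k. (\<epsilon>' i * \<epsilon> (\<pi>' i)) * (\<delta>' j * \<delta> (\<sigma>' j)) * (\<eta>' k * \<eta> (\<tau>' k)) * a ((\<pi> \<circ> \<pi>') i) ((\<sigma> \<circ> \<sigma>') j) ((\<tau> \<circ> \<tau>') k)) \<le> M"
    by (rule assms(1)[unfolded orbit_bound_def, rule_format, OF permutes_compose[OF perm'(1) perm(1)]
          permutes_compose[OF perm'(2) perm(2)] permutes_compose[OF perm'(3) perm(3)]
          comp[OF sgn'(1) sgn(1) perm'(1)] comp[OF sgn'(2) sgn(2) perm'(2)] comp[OF sgn'(3) sgn(3) perm'(3)]])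
  thus "P (\<lambda>i j k. \<epsilon>' i * \<delta>' j * \<eta>' k * (\<epsilon> (\<pi>' i) * \<delta> (\<sigma>' j) * \<eta> (\<tau>' k) * a (\<pi> (\<pi>' i)) (\<sigma> (\<sigma>' j)) (\<tau> (\<tau>' k)))) \<le> M"
    by (simp add: mult_ac)
qed

lemma orbit_bound_signs:
  assumes "orbit_bound M a" "is_sign_on N \<epsilon>" "is_sign_on N \<delta>" "is_sign_on N \<eta>"
  shows "orbit_bound M (\<lambda>i j k. \<epsilon> i * \<delta> j * \<eta> k * a i j k)"
  using orbit_bound_action[OF assms(1) permutes_id permutes_id permutes_id assms(2-4)] by simp

lemma orbit_bound_average:
  assumes "finite S" "S \<noteq> {}" "\<And>s. s \<in> S \<Longrightarrow> orbit_bound M (a s)"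
  shows "orbit_bound M (\<lambda>i j k. (\<Sum>s\<in>S. a s i j k) / real (card S))"
  unfolding orbit_bound_def
proof (intro allI impI)
  fix \<pi> \<sigma> \<tau> \<epsilon> \<delta> \<eta>
  assume g: "\<pi> permutes {1..N}" "\<sigma> permutes {1..N}" "\<tau> permutes {1..N}"
    "is_sign_on N \<epsilon>" "is_sign_on N \<delta>" "is_sign_on N \<eta>"
  let ?b = "\<lambda>s i j k. \<epsilon> i * \<delta> j * \<eta> k * a s (\<pi> i) (\<sigma> j) (\<tau> k)"
  have "P (\<lambda>i j k. \<epsilon> i * \<delta> j * \<eta> k * ((\<Sum>s\<in>S. a s (\<pi> i) (\<sigma> j) (\<tau> k)) / real (card S))) =
      P (\<lambda>i j k. \<Sum>s\<in>S. (1 / real (card S)) * ?b s i j k)"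
    by (simp add: sum_distrib_left sum_divide_distrib)
  also have "\<dots> \<le> (\<Sum>s\<in>S. \<bar>1 / real (card S)\<bar> * P (?b s))" by (rule P_sum_le[OF assms(1)])
  also have "\<dots> \<le> (\<Sum>s\<in>S. \<bar>1 / real (card S)\<bar> * M)"
    by (intro sum_mono mult_left_mono assms(3)[unfolded orbit_bound_def, rule_format, OF _ g]) auto
  also have "\<dots> = M" using assms(1,2) by simp
  finally show "P (\<lambda>i j k. \<epsilon> i * \<delta> j * \<eta> k * ((\<Sum>s\<in>S. a s (\<pi> i) (\<sigma> j) (\<tau> k)) / real (card S))) \<le> M" .
qed

text \<open>The mean of \<open>\<epsilon> (f i j k) * \<epsilon> (g i j k)\<close> over the signs is
  1 where the two indices agree and 0 elsewhere, so averaging deletes the entries off the set f = g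
  without increasing M.\<close>

lemma orbit_bound_sign_average:
  assumes "\<And>\<epsilon>. \<epsilon> \<in> sign_vectors N \<Longrightarrow> orbit_bound M (\<lambda>i j k. \<epsilon> (f i j k) * \<epsilon> (g i j k) * a i j k)"
    and "\<And>i j k. i \<in> {1..N} \<Longrightarrow> j \<in> {1..N} \<Longrightarrow> k \<in> {1..N} \<Longrightarrow> f i j k \<in> {1..N} \<and> g i j k \<in> {1..N}"
  shows "orbit_bound M (\<lambda>i j k. if f i j k = g i j k then a i j k else 0)"
proof (rule orbit_bound_cong)
  show "orbit_bound M (\<lambda>i j k. (\<Sum>\<epsilon>\<in>sign_vectors N. \<epsilon> (f i j k) * \<epsilon> (g i j k) * a i j k) / real (card (sign_vectors N)))"
    by (rule orbit_bound_average) (use assms(1) in \<open>auto simp: finite_sign_vectors sign_vectors_nonempty\<close>)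
  fix i j k assume "i \<in> {1..N}" "j \<in> {1..N}" "k \<in> {1..N}"
  from assms(2)[OF this]
  show "(\<Sum>\<epsilon>\<in>sign_vectors N. \<epsilon> (f i j k) * \<epsilon> (g i j k) * a i j k) / real (card (sign_vectors N)) =
      (if f i j k = g i j k then a i j k else 0)"
    unfolding sum_distrib_right[symmetric] by (subst sum_sign_vectors_mult) (auto simp: card_sign_vectors)
qed

lemma orbit_bound_diagonal:
  assumes "orbit_bound M a"
  shows "orbit_bound M (\<lambda>i j k. if i = j \<and> j = k then a i j k else 0)"
proof -
  have 1: "orbit_bound M (\<lambda>i j k. if i = j then a i j k else 0)"
  proof (rule orbit_bound_sign_average)
    show "orbit_bound M (\<lambda>i j k. \<epsilon> i * \<epsilon> j * a i j k)" if "\<epsilon> \<in> sign_vectors N" for \<epsilon>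
      using orbit_bound_signs[OF assms, of \<epsilon> \<epsilon> "\<lambda>_. 1"] that by simp
  qed simp
  have "orbit_bound M (\<lambda>i j k. if j = k then (if i = j then a i j k else 0) else 0)"
  proof (rule orbit_bound_sign_average)
    show "orbit_bound M (\<lambda>i j k. \<epsilon> j * \<epsilon> k * (if i = j then a i j k else 0))" if "\<epsilon> \<in> sign_vectors N" for \<epsilon>
      using orbit_bound_signs[OF 1, of "\<lambda>_. 1" \<epsilon> \<epsilon>] that by simp
  qed simp
  thus ?thesis by (rule orbit_bound_cong) simp
qed

text \<open>The same averaging with one of the two indices frozen: \<open>\<epsilon> i0\<close> is a
  constant sign, absorbed into the sign vector of the first index. The three indices are treated in
  turn.\<close>

lemma orbit_bound_entry:
  assumes "orbit_bound M a" "i0 \<in> {1..N}" "j0 \<in> {1..N}" "k0 \<in> {1..N}"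
  shows "orbit_bound M (\<lambda>i j k. if i = i0 \<and> j = j0 \<and> k = k0 then a i j k else 0)"
proof -
  have 1: "orbit_bound M (\<lambda>i j k. if i0 = i then a i j k else 0)"
  proof (rule orbit_bound_sign_average)
    show "orbit_bound M (\<lambda>i j k. \<epsilon> i0 * \<epsilon> i * a i j k)" if "\<epsilon> \<in> sign_vectors N" for \<epsilon>
      using orbit_bound_signs[OF assms(1), of "\<lambda>i. \<epsilon> i0 * \<epsilon> i" "\<lambda>_. 1" "\<lambda>_. 1"] that assms(2) by simp
  qed (use assms(2) in simp)
  have 2: "orbit_bound M (\<lambda>i j k. if j0 = j then if i0 = i then a i j k else 0 else 0)"
  proof (rule orbit_bound_sign_average)
    show "orbit_bound M (\<lambda>i j k. \<epsilon> j0 * \<epsilon> j * (if i0 = i then a i j k else 0))" if "\<epsilon> \<in> sign_vectors N" for \<epsilon>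
      using orbit_bound_signs[OF 1, of "\<lambda>_. 1" "\<lambda>i. \<epsilon> j0 * \<epsilon> i" "\<lambda>_. 1"] that assms(3) by simp
  qed (use assms(3) in simp)
  have "orbit_bound M (\<lambda>i j k. if k0 = k then if j0 = j then if i0 = i then a i j k else 0 else 0 else 0)"
  proof (rule orbit_bound_sign_average)
    show "orbit_bound M (\<lambda>i j k. \<epsilon> k0 * \<epsilon> k * (if j0 = j then if i0 = i then a i j k else 0 else 0))"
      if "\<epsilon> \<in> sign_vectors N" for \<epsilon>
      using orbit_bound_signs[OF 2, of "\<lambda>_. 1" "\<lambda>_. 1" "\<lambda>i. \<epsilon> k0 * \<epsilon> i"] that assms(4) by simp
  qed (use assms(4) in simp)
  thus ?thesis by (rule orbit_bound_cong) auto
qed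


section \<open>Comparison with single entries and with the diagonal\<close>

definition unit_entry :: "nat \<Rightarrow> nat \<Rightarrow> nat \<Rightarrow> nat \<Rightarrow> nat \<Rightarrow> nat \<Rightarrow> real" where
  "unit_entry i0 j0 k0 i j k = (if i = i0 \<and> j = j0 \<and> k = k0 then 1 else 0)"

lemma entry_le:
  assumes "orbit_bound M a" "i0 \<in> {1..N}" "j0 \<in> {1..N}" "k0 \<in> {1..N}"
  shows "\<bar>a i0 j0 k0\<bar> * P (unit_entry i0 j0 k0) \<le> M"
proof -
  have "P (\<lambda>i j k. if i = i0 \<and> j = j0 \<and> k = k0 then a i j k else 0) = P (\<lambda>i j k. a i0 j0 k0 * unit_entry i0 j0 k0 i j k)"
    by (rule P_cong) (simp add: unit_entry_def)
  thus ?thesis using orbit_boundD[OF orbit_bound_entry[OF assms]] by (simp add: P_scale)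
qed

text \<open>Together with \<open>entry_le\<close> this compares the norm with weighted coordinates
  at a loss polynomial in N. That is enough for the finiteness of the cotype constant and for errors
  of order L / 2^L.\<close>

lemma P_le_sum_entries:
  "P a \<le> (\<Sum>(i,j,k)\<in>{1..N}\<times>{1..N}\<times>{1..N}. \<bar>a i j k\<bar> * P (unit_entry i j k))"
proof -
  let ?B = "{1..N}\<times>{1..N}\<times>{1..N}"
  have "P a = P (\<lambda>i j k. \<Sum>s\<in>?B. (case s of (i0,j0,k0) \<Rightarrow> a i0 j0 k0) * (case s of (i0,j0,k0) \<Rightarrow> unit_entry i0 j0 k0) i j k)"
  proof (rule P_cong)
    fix i j k assume ijk: "i \<in> {1..N}" "j \<in> {1..N}" "k \<in> {1..N}"
    have "(\<Sum>s\<in>?B. (case s of (i0,j0,k0) \<Rightarrow> a i0 j0 k0) * (case s of (i0,j0,k0) \<Rightarrow> unit_entry i0 j0 k0) i j k) =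
        (\<Sum>s\<in>?B. if s = (i,j,k) then a i j k else 0)"
      by (intro sum.cong refl) (auto simp: unit_entry_def split: if_splits)
    also have "\<dots> = a i j k" using ijk by (simp add: sum.delta del: One_nat_def)
    finally show "a i j k = (\<Sum>s\<in>?B. (case s of (i0,j0,k0) \<Rightarrow> a i0 j0 k0) * (case s of (i0,j0,k0) \<Rightarrow> unit_entry i0 j0 k0) i j k)" ..
  qed
  also have "\<dots> \<le> (\<Sum>s\<in>?B. \<bar>case s of (i0,j0,k0) \<Rightarrow> a i0 j0 k0\<bar> * P (case s of (i0,j0,k0) \<Rightarrow> unit_entry i0 j0 k0))"
    by (rule P_sum_le) simp
  also have "\<dots> = (\<Sum>(i,j,k)\<in>?B. \<bar>a i j k\<bar> * P (unit_entry i j k))"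
    by (intro sum.cong refl) auto
  finally show ?thesis .
qed

text \<open>Applying one permutation to all three indices keeps the main diagonal, and averaging
  over all permutations replaces each diagonal entry by the mean.\<close>

lemma orbit_bound_permutation_average:
  assumes "orbit_bound M (\<lambda>i j k. if i = j \<and> j = k then b i else 0)"
  shows "orbit_bound M (\<lambda>i j k. if i = j \<and> j = k then sum b {1..N} / real N else 0)"
proof (rule orbit_bound_cong)
  let ?G = "{\<rho>. \<rho> permutes {1..N}}"
  have G: "finite ?G" by (rule finite_permutations) simp
  have "id \<in> ?G" by (simp add: permutes_id)
  hence G': "?G \<noteq> {}" by blast
  show "orbit_bound M (\<lambda>i j k. (\<Sum>\<rho>\<in>?G. if \<rho> i = \<rho> j \<and> \<rho> j = \<rho> k then b (\<rho> i) else 0) / real (card ?G))"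
  proof (rule orbit_bound_average[OF G G'])
    fix \<rho> assume "\<rho> \<in> ?G"
    hence "\<rho> permutes {1..N}" by simp
    from orbit_bound_action[OF assms this this this, of "\<lambda>_. 1" "\<lambda>_. 1" "\<lambda>_. 1"]
    show "orbit_bound M (\<lambda>i j k. if \<rho> i = \<rho> j \<and> \<rho> j = \<rho> k then b (\<rho> i) else 0)" by simp
  qed
  fix i j k assume ijk: "i \<in> {1..N}" "j \<in> {1..N}" "k \<in> {1..N}"
  have inj: "\<rho> x = \<rho> y \<longleftrightarrow> x = y" if "\<rho> \<in> ?G" for \<rho> x y
    using that by (intro inj_eq permutes_inj) simp
  have "(\<Sum>\<rho>\<in>?G. if \<rho> i = \<rho> j \<and> \<rho> j = \<rho> k then b (\<rho> i) else 0) = (\<Sum>\<rho>\<in>?G. if i = j \<and> j = k then b (\<rho> i) else 0)"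
    by (intro sum.cong refl) (simp only: inj)
  also have "\<dots> = (if i = j \<and> j = k then \<Sum>\<rho>\<in>?G. b (\<rho> i) else 0)"
    by (cases "i = j \<and> j = k") (simp_all only: if_True if_False simp_thms sum.neutral_const)
  finally have eq: "(\<Sum>\<rho>\<in>?G. if \<rho> i = \<rho> j \<and> \<rho> j = \<rho> k then b (\<rho> i) else 0) =
      (if i = j \<and> j = k then \<Sum>\<rho>\<in>?G. b (\<rho> i) else 0)" .
  show "(\<Sum>\<rho>\<in>?G. if \<rho> i = \<rho> j \<and> \<rho> j = \<rho> k then b (\<rho> i) else 0) / real (card ?G) =
      (if i = j \<and> j = k then sum b {1..N} / real N else 0)"
  proof (cases "i = j \<and> j = k")
    case True
    have "real N * (\<Sum>\<rho>\<in>?G. b (\<rho> i)) = real (card ?G) * sum b {1..N}"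
      using sum_over_permutations[OF _ ijk(1), of b] by simp
    moreover have "real N > 0" "real (card ?G) > 0" using ijk(1) G G' by (auto simp: card_gt_0_iff)
    ultimately show ?thesis unfolding eq using True by (simp add: field_simps del: One_nat_def)
  next
    case False
    thus ?thesis using eq by (simp only: if_False div_0)
  qed
qed

text \<open>The permutations move the generalised diagonal to the main one, signs in the first index
  make it nonnegative, sign averaging removes the rest and permutation averaging flattens it. The
  constant M survives all four operations.\<close>

lemma diagonal_norm_le:
  assumes "orbit_bound M a"
    and perm: "\<pi> permutes {1..N}" "\<sigma> permutes {1..N}" "\<tau> permutes {1..N}"
  shows "(\<Sum>s=1..N. \<bar>a (\<pi> s) (\<sigma> s) (\<tau> s)\<bar>) / real N * P (\<lambda>i j k. if i = j \<and> j = k then 1 else 0) \<le> M"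
proof -
  define b where "b s = a (\<pi> s) (\<sigma> s) (\<tau> s)" for s
  define \<epsilon> where "\<epsilon> s = (if b s < 0 then -1 else 1 :: real)" for s
  have "is_sign_on N \<epsilon>" by (simp add: is_sign_on_def \<epsilon>_def)
  hence "orbit_bound M (\<lambda>i j k. \<epsilon> i * 1 * 1 * a (\<pi> i) (\<sigma> j) (\<tau> k))"
    by (intro orbit_bound_action assms) auto
  from orbit_bound_diagonal[OF this]
  have "orbit_bound M (\<lambda>i j k. if i = j \<and> j = k then \<bar>b i\<bar> else 0)"
    by (rule orbit_bound_cong) (auto simp: b_def \<epsilon>_def)
  from orbit_boundD[OF orbit_bound_permutation_average[OF this]]
  have "P (\<lambda>i j k. if i = j \<and> j = k then (\<Sum>s=1..N. \<bar>b s\<bar>) / real N else 0) \<le> M" .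
  also have "P (\<lambda>i j k. if i = j \<and> j = k then (\<Sum>s=1..N. \<bar>b s\<bar>) / real N else 0) =
      P (\<lambda>i j k. (\<Sum>s=1..N. \<bar>b s\<bar>) / real N * (if i = j \<and> j = k then 1 else 0))"
    by (rule P_cong) simp
  also have "\<dots> = (\<Sum>s=1..N. \<bar>b s\<bar>) / real N * P (\<lambda>i j k. if i = j \<and> j = k then 1 else 0)"
    unfolding P_scale by (simp add: sum_nonneg)
  finally show ?thesis by (simp add: b_def)
qed

end

section \<open>The Rademacher projection and cotype\<close>

lemma powr_sum_le_sqrt_sum:
  fixes b :: "'a \<Rightarrow> real"
  assumes "finite A" "\<And>i. i \<in> A \<Longrightarrow> 0 \<le> b i" "2 \<le> q"
  shows "(\<Sum>i\<in>A. b i powr q) powr (1 / q) \<le> sqrt (\<Sum>i\<in>A. (b i)\<^sup>2)"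
proof -
  define S where "S = sqrt (\<Sum>i\<in>A. (b i)\<^sup>2)"
  have S: "0 \<le> S" "S\<^sup>2 = (\<Sum>i\<in>A. (b i)\<^sup>2)" by (simp_all add: S_def sum_nonneg)
  have bS: "b i \<le> S" if "i \<in> A" for i
    unfolding S_def using that assms(1) member_le_sum[of i A "\<lambda>i. (b i)\<^sup>2"] by (intro real_le_rsqrt) auto
  \<comment> \<open>As q >= 2, the second factor is monotone in x. Replacing it by its value at the
    Euclidean norm S bounds the sum by S^q.\<close>
  have split: "x powr q = x\<^sup>2 * x powr (q - 2)" if "0 \<le> x" for x :: real
    using that powr_add[of x 2 "q - 2"] by (cases "x = 0") simp_all
  have "(\<Sum>i\<in>A. b i powr q) \<le> (\<Sum>i\<in>A. (b i)\<^sup>2 * S powr (q - 2))"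
  proof (rule sum_mono)
    fix i assume i: "i \<in> A"
    have "b i powr (q - 2) \<le> S powr (q - 2)" using assms i bS by (intro powr_mono2) auto
    thus "b i powr q \<le> (b i)\<^sup>2 * S powr (q - 2)"
      using split[OF assms(2)[OF i]] by (simp add: mult_left_mono)
  qed
  also have "\<dots> = S powr q" by (simp add: split[OF S(1)] S(2) sum_distrib_right)
  finally have "(\<Sum>i\<in>A. b i powr q) powr (1 / q) \<le> (S powr q) powr (1 / q)"
    using assms(3) by (intro powr_mono2) (auto intro: sum_nonneg)
  also have "\<dots> = S" using assms(3) S(1) by (simp add: powr_powr)
  finally show ?thesis by (simp add: S_def)
qed

lemma sum_sign_vectors_linear_squared:
  "(\<Sum>\<epsilon>\<in>sign_vectors m. (\<Sum>t=1..m. \<epsilon> t * y t)\<^sup>2) = 2 ^ m * (\<Sum>t=1..m. (y t)\<^sup>2)"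
proof -
  have "(\<Sum>\<epsilon>\<in>sign_vectors m. (\<Sum>t=1..m. \<epsilon> t * y t)\<^sup>2) =
      (\<Sum>\<epsilon>\<in>sign_vectors m. \<Sum>t=1..m. \<Sum>u=1..m. y t * y u * (\<epsilon> t * \<epsilon> u))"
    by (simp add: power2_eq_square sum_product mult_ac)
  also have "\<dots> = (\<Sum>t=1..m. \<Sum>u=1..m. y t * y u * (\<Sum>\<epsilon>\<in>sign_vectors m. \<epsilon> t * \<epsilon> u))"
    unfolding sum_distrib_left by (rule sum_swap3)
  also have "\<dots> = (\<Sum>t=1..m. \<Sum>u=1..m. if u = t then 2 ^ m * (y t)\<^sup>2 else 0)"
    by (intro sum.cong refl) (simp add: sum_sign_vectors_mult power2_eq_square)
  also have "\<dots> = 2 ^ m * (\<Sum>t=1..m. (y t)\<^sup>2)"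
    by (simp add: sum_distrib_left)
  finally show ?thesis .
qed

text \<open>The combination of noise operators and the projection to the linear part both multiply
  Walsh coefficients by numbers depending only on \<open>card S\<close>. These differ by at most
  \<eta>, so Parseval gives the L2 bound without any dependence on m.\<close>

lemma linear_part_approximation:
  assumes "\<And>k. \<bar>(\<Sum>s\<in>I. w s * x s ^ k) - (if k = 1 then 1 else 0)\<bar> \<le> \<eta>"
  shows "(\<Sum>\<epsilon>\<in>sign_vectors m. ((\<Sum>s\<in>I. w s * (\<Sum>\<zeta>\<in>sign_vectors m. noise_kernel m (x s) \<epsilon> \<zeta> * f \<zeta>)) -
      (\<Sum>t=1..m. \<epsilon> t * walsh_coeff m f {t}))\<^sup>2) \<le> \<eta>\<^sup>2 * (\<Sum>\<epsilon>\<in>sign_vectors m. (f \<epsilon>)\<^sup>2)"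
proof -
  define c where "c k = (\<Sum>s\<in>I. w s * x s ^ k) - (if k = 1 then 1 else 0)" for k :: nat
  have lin: "(\<Sum>t=1..m. \<epsilon> t * walsh_coeff m f {t}) =
      (\<Sum>S\<in>Pow {1..m}. (if card S = 1 then 1 else 0) * (walsh_coeff m f S * walsh S \<epsilon>))" for \<epsilon>
  proof -
    have "(\<Sum>S\<in>Pow {1..m}. (if card S = 1 then 1 else 0) * (walsh_coeff m f S * walsh S \<epsilon>)) =
        (\<Sum>S\<in>(\<lambda>t. {t}) ` {1..m}. (if card S = 1 then 1 else 0) * (walsh_coeff m f S * walsh S \<epsilon>))"
    proof (rule sum.mono_neutral_right)
      show "\<forall>S\<in>Pow {1..m} - (\<lambda>t. {t}) ` {1..m}. (if card S = 1 then 1 else 0) * (walsh_coeff m f S * walsh S \<epsilon>) = 0"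
      proof
        fix S assume S: "S \<in> Pow {1..m} - (\<lambda>t. {t}) ` {1..m}"
        have "card S \<noteq> 1"
        proof
          assume "card S = 1"
          then obtain t where "S = {t}" by (rule card_1_singletonE)
          thus False using S by blast
        qed
        thus "(if card S = 1 then 1 else 0) * (walsh_coeff m f S * walsh S \<epsilon>) = 0" by simp
      qed
    qed auto
    also have "\<dots> = (\<Sum>t=1..m. \<epsilon> t * walsh_coeff m f {t})"
      by (subst sum.reindex) (simp_all add: walsh_singleton mult.commute)
    finally show ?thesis ..
  qed
  have main: "(\<Sum>s\<in>I. w s * (\<Sum>\<zeta>\<in>sign_vectors m. noise_kernel m (x s) \<epsilon> \<zeta> * f \<zeta>)) =
      (\<Sum>S\<in>Pow {1..m}. (\<Sum>s\<in>I. w s * x s ^ card S) * (walsh_coeff m f S * walsh S \<epsilon>))" for \<epsilon>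
    unfolding noise_operator_walsh sum_distrib_left sum_distrib_right
    by (subst sum.swap) (simp add: mult_ac)
  have "(\<Sum>\<epsilon>\<in>sign_vectors m. ((\<Sum>s\<in>I. w s * (\<Sum>\<zeta>\<in>sign_vectors m. noise_kernel m (x s) \<epsilon> \<zeta> * f \<zeta>)) -
      (\<Sum>t=1..m. \<epsilon> t * walsh_coeff m f {t}))\<^sup>2) =
      (\<Sum>\<epsilon>\<in>sign_vectors m. (\<Sum>S\<in>Pow {1..m}. c (card S) * walsh_coeff m f S * walsh S \<epsilon>)\<^sup>2)"
    unfolding main lin sum_subtractf[symmetric] c_def left_diff_distrib by (simp only: mult.assoc)
  also have "\<dots> = 2 ^ m * (\<Sum>S\<in>Pow {1..m}. (c (card S) * walsh_coeff m f S)\<^sup>2)"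
    by (rule walsh_expansion_parseval)
  also have "\<dots> \<le> 2 ^ m * (\<Sum>S\<in>Pow {1..m}. \<eta>\<^sup>2 * (walsh_coeff m f S)\<^sup>2)"
  proof (intro mult_left_mono sum_mono)
    fix S :: "nat set"
    have "(c (card S))\<^sup>2 \<le> \<eta>\<^sup>2" using assms[of "card S"] unfolding c_def by (rule abs_le_square_iff[THEN iffD1, OF order.trans[OF _ abs_ge_self]])
    thus "(c (card S) * walsh_coeff m f S)\<^sup>2 \<le> \<eta>\<^sup>2 * (walsh_coeff m f S)\<^sup>2"
      by (simp add: power_mult_distrib mult_right_mono)
  qed simp
  also have "\<dots> = \<eta>\<^sup>2 * (\<Sum>\<epsilon>\<in>sign_vectors m. (f \<epsilon>)\<^sup>2)"
    unfolding sum_distrib_left[symmetric] walsh_parseval by simp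
  finally show ?thesis .
qed

lemma sum_abs_squared_le:
  fixes f :: "'a \<Rightarrow> real"
  shows "(\<Sum>i\<in>A. \<bar>f i\<bar>)\<^sup>2 \<le> real (card A) * (\<Sum>i\<in>A. (f i)\<^sup>2)"
  using sum_squared_le_sum_of_squares[of "\<lambda>i. \<bar>f i\<bar>" A] by (cases "finite A") (simp_all add: mult.commute)

section \<open>Cotype and the linear part for tensor-symmetric norms\<close>

context tensor_symmetric_norm
begin

abbreviation box :: "(nat \<times> nat \<times> nat) set" where
  "box \<equiv> {1..N} \<times> {1..N} \<times> {1..N}"

text \<open>Needed because the infimum defining the cotype constant is only meaningful on a nonempty set.\<close>

lemma ex_cotype_bound:
  assumes "2 \<le> q"
  shows "\<exists>C>0. has_cotype_bound (tensor_space N) p q C"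
proof (intro exI conjI)
  define D where "D = real (card box) * K"
  have D: "0 \<le> D" using K by (simp add: D_def)
  \<comment> \<open>The summand 1 keeps the constant positive when N = 0, where \<open>D\<close>
    vanishes.\<close>
  show "0 < D + 1" using D by simp
  \<comment> \<open>Coordinates weighted by the norms of the elementary tensors. The norm
    \<open>p\<close> and the Euclidean norm of \<open>y\<close> bound each other, with losses whose
    product is \<open>D\<close>; for the Euclidean norm, orthogonality of the signs gives cotype 2
    with equality.\<close>
  define y where "y = (\<lambda>x (i,j,k). P (unit_entry i j k) * Poly_Mapping.lookup x (i,j,k))"
  have upper: "(p x)\<^sup>2 \<le> real (card box) * (\<Sum>s\<in>box. (y x s)\<^sup>2)" if x: "x \<in> tensor_space N" for x
  proof -
    have "p x = P (\<lambda>i j k. Poly_Mapping.lookup x (i, j, k))"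
      unfolding P_def tensor_of_lookup[OF x, symmetric] ..
    also have "\<dots> \<le> (\<Sum>s\<in>box. \<bar>y x s\<bar>)"
      using P_le_sum_entries[of "\<lambda>i j k. Poly_Mapping.lookup x (i, j, k)"]
      by (simp add: y_def abs_mult P_nonneg mult.commute split_beta)
    finally have "(p x)\<^sup>2 \<le> (\<Sum>s\<in>box. \<bar>y x s\<bar>)\<^sup>2" by (intro power_mono norm_facts(2)[OF x])
    also have "\<dots> \<le> real (card box) * (\<Sum>s\<in>box. (y x s)\<^sup>2)" by (rule sum_abs_squared_le)
    finally show ?thesis .
  qed
  have lower: "(\<Sum>s\<in>box. (y x s)\<^sup>2) \<le> real (card box) * (K * p x)\<^sup>2" if x: "x \<in> tensor_space N" for x
  proof -
    have "(y x s)\<^sup>2 \<le> (K * p x)\<^sup>2" if box: "s \<in> box" for s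
    proof -
      obtain i j k where s: "s = (i, j, k)" "i \<in> {1..N}" "j \<in> {1..N}" "k \<in> {1..N}" using box by blast
      have "\<bar>y x s\<bar> \<le> K * P (\<lambda>i j k. Poly_Mapping.lookup x (i, j, k))"
        using entry_le[OF orbit_bound_self s(2-4), of "\<lambda>i j k. Poly_Mapping.lookup x (i, j, k)"]
        by (simp add: y_def s abs_mult P_nonneg mult.commute)
      also have "\<dots> = K * p x" unfolding P_def tensor_of_lookup[OF x, symmetric] ..
      finally show ?thesis by (rule abs_le_square_iff[THEN iffD1, OF order.trans[OF _ abs_ge_self]])
    qed
    thus ?thesis by (rule sum_bounded_above)
  qed
  show "has_cotype_bound (tensor_space N) p q (D + 1)"
    unfolding has_cotype_bound_def expectation_sign_vectors
  proof (intro allI impI)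
    fix m :: nat and x :: "nat \<Rightarrow> tensor3"
    assume "\<forall>i\<in>{1..m}. x i \<in> tensor_space N"
    hence x: "x t \<in> tensor_space N" if "t \<in> {1..m}" for t using that by blast
    have sumx: "(\<Sum>t=1..m. \<epsilon> t *\<^sub>R x t) \<in> tensor_space N" for \<epsilon>
      by (intro subspace_sum subspace_scale norm_facts(1) x)
    have ysum: "y (\<Sum>t=1..m. \<epsilon> t *\<^sub>R x t) s = (\<Sum>t=1..m. \<epsilon> t * y (x t) s)" for \<epsilon> s
      by (cases s) (simp add: y_def lookup_sum lookup_scaleR sum_distrib_left mult_ac)
    define E where "E = (\<Sum>\<epsilon>\<in>sign_vectors m. (p (\<Sum>t=1..m. \<epsilon> t *\<^sub>R x t))\<^sup>2) / 2 ^ m"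
    have "(\<Sum>t=1..m. (p (x t))\<^sup>2) \<le> (\<Sum>t=1..m. real (card box) * (\<Sum>s\<in>box. (y (x t) s)\<^sup>2))"
      by (intro sum_mono upper x)
    also have "\<dots> = real (card box) * (\<Sum>s\<in>box. \<Sum>t=1..m. (y (x t) s)\<^sup>2)"
      unfolding sum_distrib_left[symmetric] by (subst sum.swap) (rule refl)
    also have "(\<Sum>s\<in>box. \<Sum>t=1..m. (y (x t) s)\<^sup>2) =
        (\<Sum>s\<in>box. (\<Sum>\<epsilon>\<in>sign_vectors m. (y (\<Sum>t=1..m. \<epsilon> t *\<^sub>R x t) s)\<^sup>2) / 2 ^ m)"
      unfolding ysum sum_sign_vectors_linear_squared by simp
    also have "\<dots> = (\<Sum>\<epsilon>\<in>sign_vectors m. \<Sum>s\<in>box. (y (\<Sum>t=1..m. \<epsilon> t *\<^sub>R x t) s)\<^sup>2) / 2 ^ m"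
      unfolding sum_divide_distrib[symmetric] by (subst sum.swap) (rule refl)
    also have "\<dots> \<le> (\<Sum>\<epsilon>\<in>sign_vectors m. real (card box) * (K * p (\<Sum>t=1..m. \<epsilon> t *\<^sub>R x t))\<^sup>2) / 2 ^ m"
      by (intro divide_right_mono sum_mono lower sumx) simp
    also have "\<dots> = real (card box) * K\<^sup>2 * E"
      by (simp add: E_def sum_distrib_left power_mult_distrib sum_divide_distrib mult_ac)
    finally have "(\<Sum>t=1..m. (p (x t))\<^sup>2) \<le> real (card box) * (real (card box) * K\<^sup>2 * E)"
      by (simp add: mult_left_mono)
    also have "\<dots> = D\<^sup>2 * E" by (simp add: D_def power2_eq_square)
    finally have "sqrt (\<Sum>t=1..m. (p (x t))\<^sup>2) \<le> D * sqrt E"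
      using D by (metis real_sqrt_abs real_sqrt_le_iff real_sqrt_mult abs_of_nonneg)
    moreover have "0 \<le> sqrt E" by (simp add: E_def sum_nonneg)
    moreover have "(\<Sum>t=1..m. p (x t) powr q) powr (1 / q) \<le> sqrt (\<Sum>t=1..m. (p (x t))\<^sup>2)"
      by (intro powr_sum_le_sqrt_sum assms norm_facts(2) x) simp
    ultimately show "(\<Sum>t=1..m. p (x t) powr q) powr (1 / q) \<le> (D + 1) *
        sqrt ((\<Sum>\<epsilon>\<in>sign_vectors m. (p (\<Sum>t=1..m. \<epsilon> t *\<^sub>R x t))\<^sup>2) / 2 ^ m)"
      unfolding E_def[symmetric] distrib_right mult_1 by linarith
  qed
qed


text \<open>The linear part is split as G - R. G combines averages of values of the tensor-valued
  function, which gives a pointwise bound 4 L M. R is tiny in L2 in each entry, so the crude passage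
  from entries to the norm is affordable.\<close>

lemma rademacher_projection_bound:
  assumes "1 \<le> L" and NL: "real N ^ 3 \<le> 27 * 2 ^ L"
    and X: "\<And>\<epsilon>. \<epsilon> \<in> sign_vectors m \<Longrightarrow> is_sign_on N (X \<epsilon>)"
  defines "a \<equiv> \<lambda>t i j k. walsh_coeff m (\<lambda>\<epsilon>. X \<epsilon> i * X \<epsilon> j * X \<epsilon> k) {t}"
  shows "(\<Sum>\<epsilon>\<in>sign_vectors m. (p (\<Sum>t=1..m. \<epsilon> t *\<^sub>R tensor_of N (a t)))\<^sup>2) / 2 ^ m \<le>
    (80 * real L * (K * P (\<lambda>i j k. 1)))\<^sup>2"
proof -
  define M where "M = K * P (\<lambda>i j k. 1)"
  have M0: "0 \<le> M" using K P_nonneg by (simp add: M_def)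
  define F where "F \<epsilon> i j k = X \<epsilon> i * X \<epsilon> j * X \<epsilon> k" for \<epsilon> i j k
  obtain w x :: "nat \<Rightarrow> real" where w: "(\<Sum>s<4*L. \<bar>w s\<bar>) \<le> 4 * real L" and x: "\<And>s. \<bar>x s\<bar> \<le> 1"
    and lin: "\<And>k. \<bar>(\<Sum>s<4*L. w s * x s ^ k) - (if k = 1 then 1 else 0)\<bar> \<le> 2 * real L / 2 ^ L"
    using linear_part_weights[OF assms(1)] by blast
  define T where "T s \<epsilon> i j k = (\<Sum>\<zeta>\<in>sign_vectors m. noise_kernel m (x s) \<epsilon> \<zeta> * F \<zeta> i j k)" for s \<epsilon> i j k
  define G where "G \<epsilon> i j k = (\<Sum>s<4*L. w s * T s \<epsilon> i j k)" for \<epsilon> i j k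
  define R where "R \<epsilon> i j k = G \<epsilon> i j k - (\<Sum>t=1..m. \<epsilon> t * a t i j k)" for \<epsilon> i j k
  \<comment> \<open>F \<zeta> is the all-ones tensor with sign changes in the three indices, so it
    lies in the orbit of that tensor.\<close>
  have PF: "P (F \<zeta>) \<le> M" if "\<zeta> \<in> sign_vectors m" for \<zeta>
    using orbit_boundD[OF orbit_bound_signs[OF orbit_bound_self X[OF that] X[OF that] X[OF that]], of "\<lambda>i j k. 1"]
    by (simp add: M_def F_def[abs_def])
  have PT: "P (T s \<epsilon>) \<le> M" if e: "\<epsilon> \<in> sign_vectors m" for s \<epsilon>
  proof -
    have "P (T s \<epsilon>) \<le> (\<Sum>\<zeta>\<in>sign_vectors m. \<bar>noise_kernel m (x s) \<epsilon> \<zeta>\<bar> * P (F \<zeta>))"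
      unfolding T_def by (rule P_sum_le[OF finite_sign_vectors])
    also have "\<dots> \<le> (\<Sum>\<zeta>\<in>sign_vectors m. noise_kernel m (x s) \<epsilon> \<zeta> * M)"
      using noise_kernel_nonneg[OF x e] PF by (intro sum_mono) (simp add: mult_left_mono)
    also have "\<dots> = M" unfolding sum_distrib_right[symmetric] sum_noise_kernel by simp
    finally show ?thesis .
  qed
  have PG: "P (G \<epsilon>) \<le> 4 * real L * M" if e: "\<epsilon> \<in> sign_vectors m" for \<epsilon>
  proof -
    have "P (G \<epsilon>) \<le> (\<Sum>s<4*L. \<bar>w s\<bar> * P (T s \<epsilon>))" unfolding G_def by (rule P_sum_le) simp
    also have "\<dots> \<le> (\<Sum>s<4*L. \<bar>w s\<bar> * M)" by (intro sum_mono mult_left_mono PT e) simp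
    also have "\<dots> \<le> 4 * real L * M" unfolding sum_distrib_right[symmetric] using w M0 by (rule mult_right_mono)
    finally show ?thesis .
  qed
  define r where "r \<epsilon> = (\<Sum>(i,j,k)\<in>box. \<bar>R \<epsilon> i j k\<bar>)" for \<epsilon>
  have PR: "P (R \<epsilon>) \<le> M * r \<epsilon>" for \<epsilon>
  proof -
    have "P (R \<epsilon>) \<le> (\<Sum>(i,j,k)\<in>box. \<bar>R \<epsilon> i j k\<bar> * P (unit_entry i j k))" by (rule P_le_sum_entries)
    also have "\<dots> \<le> (\<Sum>(i,j,k)\<in>box. \<bar>R \<epsilon> i j k\<bar> * M)"
    proof (rule sum_mono)
      fix s assume "s \<in> box"
      then obtain i j k where s: "s = (i, j, k)" "i \<in> {1..N}" "j \<in> {1..N}" "k \<in> {1..N}" by blast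
      \<comment> \<open>Every elementary tensor is isolated from the all-ones tensor by sign
        averaging, hence obeys the same bound M.\<close>
      have "P (unit_entry i j k) \<le> M"
        using entry_le[OF orbit_bound_self s(2-4), of "\<lambda>i j k. 1"] by (simp add: M_def)
      thus "(case s of (i, j, k) \<Rightarrow> \<bar>R \<epsilon> i j k\<bar> * P (unit_entry i j k)) \<le> (case s of (i, j, k) \<Rightarrow> \<bar>R \<epsilon> i j k\<bar> * M)"
        by (simp add: s mult_left_mono)
    qed
    also have "\<dots> = M * r \<epsilon>" by (simp add: r_def sum_distrib_left split_beta mult.commute)
    finally show ?thesis .
  qed
  have PA: "(p (\<Sum>t=1..m. \<epsilon> t *\<^sub>R tensor_of N (a t)))\<^sup>2 \<le> 2 * (4 * real L * M)\<^sup>2 + 2 * M\<^sup>2 * (r \<epsilon>)\<^sup>2"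
    if e: "\<epsilon> \<in> sign_vectors m" for \<epsilon>
  proof -
    have "p (\<Sum>t=1..m. \<epsilon> t *\<^sub>R tensor_of N (a t)) = P (\<lambda>i j k. \<Sum>t=1..m. \<epsilon> t * a t i j k)"
      unfolding P_def tensor_of_sum ..
    also have "\<dots> = P (\<lambda>i j k. G \<epsilon> i j k + (-1) * R \<epsilon> i j k)" by (simp add: R_def)
    also have "\<dots> \<le> P (G \<epsilon>) + P (\<lambda>i j k. (-1) * R \<epsilon> i j k)" by (rule P_add_le)
    also have "\<dots> \<le> 4 * real L * M + M * r \<epsilon>" using PG[OF e] PR[of \<epsilon>] unfolding P_scale by simp
    finally have "(p (\<Sum>t=1..m. \<epsilon> t *\<^sub>R tensor_of N (a t)))\<^sup>2 \<le> (4 * real L * M + M * r \<epsilon>)\<^sup>2"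
      by (intro power_mono norm_facts(2) subspace_sum subspace_scale norm_facts(1) tensor_of_in_space)
    also have "\<dots> \<le> 2 * (4 * real L * M)\<^sup>2 + 2 * (M * r \<epsilon>)\<^sup>2"
      using sum_squares_bound[of "4 * real L * M" "M * r \<epsilon>"] by (simp add: power2_sum)
    finally show ?thesis by (simp add: power_mult_distrib)
  qed
  define \<eta> where "\<eta> = 2 * real L / 2 ^ L"
  have "(\<Sum>\<epsilon>\<in>sign_vectors m. (R \<epsilon> i j k)\<^sup>2) \<le> \<eta>\<^sup>2 * 2 ^ m" if ijk: "(i, j, k) \<in> box" for i j k
  proof -
    have "(\<Sum>\<epsilon>\<in>sign_vectors m. (R \<epsilon> i j k)\<^sup>2) \<le> \<eta>\<^sup>2 * (\<Sum>\<epsilon>\<in>sign_vectors m. (F \<epsilon> i j k)\<^sup>2)"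
      unfolding R_def G_def T_def a_def F_def \<eta>_def by (rule linear_part_approximation[OF lin])
    also have "(\<Sum>\<epsilon>\<in>sign_vectors m. (F \<epsilon> i j k)\<^sup>2) = (\<Sum>\<epsilon>\<in>sign_vectors m. 1)"
    proof (rule sum.cong[OF refl])
      fix \<epsilon> assume "\<epsilon> \<in> sign_vectors m"
      hence "(X \<epsilon> l)\<^sup>2 = 1" if "l \<in> {1..N}" for l using X that unfolding is_sign_on_def by fastforce
      thus "(F \<epsilon> i j k)\<^sup>2 = 1" using ijk unfolding F_def power_mult_distrib by simp
    qed
    finally show ?thesis by (simp add: card_sign_vectors)
  qed
  hence Rsum: "(\<Sum>(i,j,k)\<in>box. \<Sum>\<epsilon>\<in>sign_vectors m. (R \<epsilon> i j k)\<^sup>2) \<le> real (card box) * (\<eta>\<^sup>2 * 2 ^ m)"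
    by (intro sum_bounded_above) auto
  have card_box: "real (card box) = real N ^ 3" by (simp add: power3_eq_cube)
  \<comment> \<open>Cauchy-Schwarz over the box costs one factor N^3, and summing the entrywise
    bounds costs another.\<close>
  have "(\<Sum>\<epsilon>\<in>sign_vectors m. (r \<epsilon>)\<^sup>2) \<le> (\<Sum>\<epsilon>\<in>sign_vectors m. real (card box) * (\<Sum>(i,j,k)\<in>box. (R \<epsilon> i j k)\<^sup>2))"
  proof (rule sum_mono)
    fix \<epsilon>
    show "(r \<epsilon>)\<^sup>2 \<le> real (card box) * (\<Sum>(i,j,k)\<in>box. (R \<epsilon> i j k)\<^sup>2)"
      using sum_abs_squared_le[of "\<lambda>(i,j,k). R \<epsilon> i j k" box] by (simp add: r_def split_beta)
  qed
  also have "\<dots> = real (card box) * (\<Sum>(i,j,k)\<in>box. \<Sum>\<epsilon>\<in>sign_vectors m. (R \<epsilon> i j k)\<^sup>2)"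
    unfolding sum_distrib_left[symmetric] split_beta by (subst sum.swap) (rule refl)
  also have "\<dots> \<le> real (card box) * (real (card box) * (\<eta>\<^sup>2 * 2 ^ m))"
    using Rsum by (rule mult_left_mono) simp
  also have "\<dots> = (real N ^ 3 * \<eta>)\<^sup>2 * 2 ^ m" unfolding card_box by (simp add: power2_eq_square)
  also have "\<dots> \<le> (54 * real L)\<^sup>2 * 2 ^ m"
  proof -
    \<comment> \<open>The size of L cancels the denominator 2^L of \<eta> and leaves 27 times 2
      L.\<close>
    have "real N ^ 3 * \<eta> \<le> 27 * 2 ^ L * \<eta>" using NL by (rule mult_right_mono) (simp add: \<eta>_def)
    also have "\<dots> = 54 * real L" by (simp add: \<eta>_def)
    finally show ?thesis by (intro mult_right_mono power_mono) (simp_all add: \<eta>_def)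
  qed
  finally have r: "(\<Sum>\<epsilon>\<in>sign_vectors m. (r \<epsilon>)\<^sup>2) \<le> (54 * real L)\<^sup>2 * 2 ^ m" .
  have "(\<Sum>\<epsilon>\<in>sign_vectors m. (p (\<Sum>t=1..m. \<epsilon> t *\<^sub>R tensor_of N (a t)))\<^sup>2) \<le>
      (\<Sum>\<epsilon>\<in>sign_vectors m. 2 * (4 * real L * M)\<^sup>2 + 2 * M\<^sup>2 * (r \<epsilon>)\<^sup>2)"
    by (rule sum_mono[OF PA])
  also have "\<dots> = 2 ^ m * (2 * (4 * real L * M)\<^sup>2) + 2 * M\<^sup>2 * (\<Sum>\<epsilon>\<in>sign_vectors m. (r \<epsilon>)\<^sup>2)"
    by (simp add: sum.distrib sum_distrib_left card_sign_vectors)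
  also have "\<dots> \<le> 2 ^ m * (2 * (4 * real L * M)\<^sup>2) + 2 * M\<^sup>2 * ((54 * real L)\<^sup>2 * 2 ^ m)"
    by (intro add_left_mono mult_left_mono r) simp
  \<comment> \<open>5864 = 2 * 4^2 + 2 * 54^2, and 6400 = 80^2 is a convenient square above
    it.\<close>
  also have "\<dots> = 2 ^ m * (5864 * (real L * M)\<^sup>2)" by (simp add: power_mult_distrib)
  also have "\<dots> \<le> 2 ^ m * (6400 * (real L * M)\<^sup>2)" by (intro mult_left_mono mult_right_mono) auto
  also have "\<dots> = 2 ^ m * (80 * real L * M)\<^sup>2" by (simp add: power_mult_distrib)
  finally show ?thesis by (simp add: M_def field_simps)
qed

end

section \<open>Choice of the degree and the final constants\<close>

lemma ex_logarithmic_degree: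
  assumes "1 \<le> n"
  obtains L :: nat where "1 \<le> L" "real (3 * n) ^ 3 \<le> 27 * 2 ^ L" "real L \<le> 12 * ln (real n + 1)"
proof -
  \<comment> \<open>The degree is 3 l, so that 2 to this power is at least n^3. Rounding up at most
    doubles the logarithm, which is at least 1, and 1 / ln 2 <= 2; this gives 12 = 3 * 2 *
    2.\<close>
  define l where "l = nat \<lceil>log 2 (real n + 1)\<rceil>"
  have log1: "1 \<le> log 2 (real n + 1)" using assms by (subst le_log_iff) auto
  have l: "log 2 (real n + 1) \<le> real l" "real l \<le> log 2 (real n + 1) + 1"
    unfolding l_def using log1 by linarith+
  have "real n + 1 \<le> 2 powr real l" using l(1) by (subst (asm) log_le_iff) auto
  also have "2 powr real l = 2 ^ l" by (rule powr_realpow) simp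
  finally have "real n \<le> 2 ^ l" by linarith
  hence "real n ^ 3 \<le> (2 ^ l) ^ 3" by (intro power_mono) auto
  hence "real (3 * n) ^ 3 \<le> 27 * 2 ^ (3 * l)" by (simp add: power_mult_distrib power_mult[symmetric] mult.commute)
  moreover have "1 \<le> 3 * l" using l(1) log1 by linarith
  moreover have "real (3 * l) \<le> 12 * ln (real n + 1)"
  proof -
    have "real (3 * l) \<le> 6 * log 2 (real n + 1)" using l(2) log1 unfolding of_nat_mult of_nat_numeral by linarith
    also have "\<dots> = 6 * ln (real n + 1) / ln 2" by (simp add: log_def)
    also have "\<dots> \<le> 6 * ln (real n + 1) / (1 / 2)"
      using ln2_ge_two_thirds assms by (intro divide_left_mono) auto
    finally show ?thesis by simp
  qed
  ultimately show ?thesis using that by blast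
qed

theorem theorem1p3:
  shows "\<exists>\<kappa>::real. 0 < \<kappa> \<and>
    (\<forall>(m::nat) (n::nat) (\<phi>::real) (\<theta>::real).
       1 \<le> m \<and> 1 \<le> n \<and> \<phi> \<in> {0<..<1/2} \<and> \<theta> \<in> {0<..<1/2} \<and>
       (\<exists>C. locally_decodable_code3 m n \<phi> \<theta> C) \<longrightarrow>
       (\<forall>(K::real) (p :: tensor3 \<Rightarrow> real) (q::real).
          1 \<le> K \<and> is_norm_on (tensor_space (3 * n)) p \<and> tensor_symmetric (3 * n) K p \<and> 2 \<le> q \<longrightarrow>
          K\<^sup>2 * cotype_const (tensor_space (3 * n)) p q *
            (p (\<Sum>i=1..3*n. \<Sum>j=1..3*n. \<Sum>k=1..3*n. e3 i j k) / p (\<Sum>i=1..3*n. e3 i i i))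
          \<ge> \<kappa> * (\<phi> * \<theta>\<^sup>2 * real m powr (1/q) / ln (real n + 1))))"
proof (rule exI[of _ "1/34560"], intro conjI allI impI)
  \<comment> \<open>34560 = 36 * 960, where 36 comes from the lower bound for each degree-one
    coefficient and 960 = 80 * 12 from the bound on their Rademacher sum.\<close>
  show "0 < (1/34560 :: real)" by simp
  fix m n :: nat and \<phi> \<theta> K :: real and p :: "tensor3 \<Rightarrow> real" and q :: real
  assume "1 \<le> m \<and> 1 \<le> n \<and> \<phi> \<in> {0<..<1/2} \<and> \<theta> \<in> {0<..<1/2} \<and>
    (\<exists>C. locally_decodable_code3 m n \<phi> \<theta> C)"
  then obtain C where n: "1 \<le> n" and \<phi>: "0 < \<phi>" and \<theta>: "0 < \<theta>" "\<theta> < 1/2"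
    and code: "locally_decodable_code3 m n \<phi> \<theta> C" by auto
  assume asm: "1 \<le> K \<and> is_norm_on (tensor_space (3 * n)) p \<and> tensor_symmetric (3 * n) K p \<and> 2 \<le> q"
  interpret T: tensor_symmetric_norm "3 * n" K p by unfold_locales (use asm in blast)+
  have q: "2 \<le> q" and K: "0 < K" using asm by simp_all
  define J where "J = T.P (\<lambda>i j k. 1)"
  define D where "D = T.P (\<lambda>i j k. if i = j \<and> j = k then 1 else 0)"
  have J: "0 < J" unfolding J_def by (rule T.P_pos[of 1 1 1]) (use n in auto)
  have D: "0 < D" unfolding D_def by (rule T.P_pos[of 1 1 1]) (use n in auto)
  define X where "X \<epsilon> = pad_one n (C \<epsilon>)" for \<epsilon>
  have X: "is_sign_on (3 * n) (X \<epsilon>)" if "\<epsilon> \<in> sign_vectors m" for \<epsilon>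
  proof -
    have "C \<epsilon> \<in> sign_vectors n" using code that unfolding locally_decodable_code3_def by blast
    from sign_vectors_cases[OF this] show ?thesis by (simp add: X_def is_sign_on_def pad_one_def)
  qed
  define a where "a t i j k = walsh_coeff m (\<lambda>\<epsilon>. X \<epsilon> i * X \<epsilon> j * X \<epsilon> k) {t}" for t i j k
  \<comment> \<open>36 = 3 * 4 * 3: at least \<phi> n / 3 diagonal entries, each at least \<theta> /
    4 in modulus, averaged over 3 n positions.\<close>
  have lower: "\<phi> * \<theta> / 36 * D / K \<le> T.P (a t)" if t: "t \<in> {1..m}" for t
  proof -
    obtain \<pi> \<sigma> \<tau> r where perm: "\<pi> permutes {1..3*n}" "\<sigma> permutes {1..3*n}" "\<tau> permutes {1..3*n}"
      and r: "r \<le> 3 * n" "\<phi> * real n / 3 \<le> real r"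
      and coeff: "\<And>s. s \<in> {1..r} \<Longrightarrow> \<theta> / 4 \<le> \<bar>a t (\<pi> s) (\<sigma> s) (\<tau> s)\<bar>"
      using decodable_diagonal[OF code t \<theta>(1) \<phi>] unfolding a_def X_def by blast
    have "\<phi> * real n / 3 * (\<theta> / 4) \<le> real r * (\<theta> / 4)" using r(2) \<theta> by (intro mult_right_mono) auto
    also have "\<dots> = (\<Sum>s=1..r. \<theta> / 4)" by simp
    also have "\<dots> \<le> (\<Sum>s=1..r. \<bar>a t (\<pi> s) (\<sigma> s) (\<tau> s)\<bar>)" by (rule sum_mono[OF coeff])
    also have "\<dots> \<le> (\<Sum>s=1..3*n. \<bar>a t (\<pi> s) (\<sigma> s) (\<tau> s)\<bar>)" using r(1) by (intro sum_mono2) auto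
    finally have "\<phi> * real n / 3 * (\<theta> / 4) / real (3 * n) \<le> (\<Sum>s=1..3*n. \<bar>a t (\<pi> s) (\<sigma> s) (\<tau> s)\<bar>) / real (3 * n)"
      by (rule divide_right_mono) simp
    moreover have "\<phi> * real n / 3 * (\<theta> / 4) / real (3 * n) = \<phi> * \<theta> / 36" using n by simp
    ultimately have "\<phi> * \<theta> / 36 * D \<le> (\<Sum>s=1..3*n. \<bar>a t (\<pi> s) (\<sigma> s) (\<tau> s)\<bar>) / real (3 * n) * D"
      using D by (intro mult_right_mono) auto
    also have "\<dots> \<le> K * T.P (a t)"
      unfolding D_def by (rule T.diagonal_norm_le[OF T.orbit_bound_self perm])
    finally show ?thesis using K by (simp add: field_simps)
  qed
  obtain L :: nat where L: "1 \<le> L" "real (3 * n) ^ 3 \<le> 27 * 2 ^ L" "real L \<le> 12 * ln (real n + 1)"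
    using ex_logarithmic_degree[OF n] .
  define \<Lambda> where "\<Lambda> = ln (real n + 1)"
  have \<Lambda>: "0 < \<Lambda>" using n by (simp add: \<Lambda>_def)
  define x where "x t = tensor_of (3 * n) (a t)" for t
  have "(\<Sum>\<epsilon>\<in>sign_vectors m. (p (\<Sum>t=1..m. \<epsilon> t *\<^sub>R x t))\<^sup>2) / 2 ^ m \<le> (80 * real L * (K * J))\<^sup>2"
    using T.rademacher_projection_bound[OF L(1,2) X] unfolding J_def x_def a_def by simp
  hence "sqrt ((\<Sum>\<epsilon>\<in>sign_vectors m. (p (\<Sum>t=1..m. \<epsilon> t *\<^sub>R x t))\<^sup>2) / 2 ^ m) \<le> 80 * real L * (K * J)"
    using K J by (intro real_le_lsqrt) auto
  also have "\<dots> \<le> 80 * (12 * \<Lambda>) * (K * J)"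
    using K J L(3) by (intro mult_right_mono mult_left_mono) (auto simp: \<Lambda>_def)
  finally have upper: "sqrt ((\<Sum>\<epsilon>\<in>sign_vectors m. (p (\<Sum>t=1..m. \<epsilon> t *\<^sub>R x t))\<^sup>2) / 2 ^ m) \<le> 960 * \<Lambda> * (K * J)"
    by simp
  define A where "A = \<phi> * \<theta> / 36 * D / K"
  have A: "0 < A" using \<phi> \<theta> D K by (simp add: A_def)
  \<comment> \<open>For an admissible cotype constant c, m tensors of norm at least A make the left
    side of the cotype inequality at least m^(1/q) A, while \<open>upper\<close> controls its right
    side.\<close>
  have bound: "real m powr (1/q) * A / (960 * \<Lambda> * (K * J)) \<le> c"
    if "0 < c" "has_cotype_bound (tensor_space (3 * n)) p q c" for c
  proof -
    have "(real m * A powr q) powr (1/q) \<le> (\<Sum>t=1..m. p (x t) powr q) powr (1/q)"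
    proof (rule powr_mono2)
      have "real m * A powr q = (\<Sum>t=1..m. A powr q)" by simp
      also have "\<dots> \<le> (\<Sum>t=1..m. p (x t) powr q)"
      proof (rule sum_mono)
        fix t assume "t \<in> {1..m}"
        from lower[OF this] have "A \<le> p (x t)" by (simp add: A_def x_def T.P_def)
        thus "A powr q \<le> p (x t) powr q" using A q by (intro powr_mono2) auto
      qed
      finally show "real m * A powr q \<le> (\<Sum>t=1..m. p (x t) powr q)" .
    qed (use q in auto)
    also have "\<dots> \<le> c * sqrt ((\<Sum>\<epsilon>\<in>sign_vectors m. (p (\<Sum>t=1..m. \<epsilon> t *\<^sub>R x t))\<^sup>2) / 2 ^ m)"
      using that(2)[unfolded has_cotype_bound_def expectation_sign_vectors, rule_format, of m x]
      by (simp add: x_def tensor_of_in_space)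
    also have "\<dots> \<le> c * (960 * \<Lambda> * (K * J))" using upper that(1) by (intro mult_left_mono) auto
    finally have "real m powr (1/q) * A \<le> c * (960 * \<Lambda> * (K * J))"
      using A q by (simp add: powr_mult powr_powr)
    thus ?thesis using \<Lambda> K J by (simp add: pos_divide_le_eq)
  qed
  \<comment> \<open>The set of admissible constants is nonempty, so its infimum inherits their
    common lower bound.\<close>
  have "real m powr (1/q) * A / (960 * \<Lambda> * (K * J)) \<le> cotype_const (tensor_space (3 * n)) p q"
    unfolding cotype_const_def
    by (rule cInf_greatest) (use T.ex_cotype_bound[OF q] bound in auto)
  hence "K\<^sup>2 * (J / D) * (real m powr (1/q) * A / (960 * \<Lambda> * (K * J))) \<le>
      K\<^sup>2 * (J / D) * cotype_const (tensor_space (3 * n)) p q"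
    using J D by (intro mult_left_mono) auto
  \<comment> \<open>The lower and the upper bound each lose one factor K, and the square of K
    compensates for both.\<close>
  moreover have "K\<^sup>2 * (J / D) * (real m powr (1/q) * A / (960 * \<Lambda> * (K * J))) =
      1/34560 * (\<phi> * \<theta> * real m powr (1/q) / \<Lambda>)"
    using K J D \<Lambda> by (simp add: A_def field_simps power2_eq_square)
  \<comment> \<open>The estimate obtained is linear in \<theta>; since 0 < \<theta> < 1 it implies
    the quadratic one.\<close>
  moreover have "1/34560 * (\<phi> * \<theta>\<^sup>2 * real m powr (1/q) / \<Lambda>) \<le> 1/34560 * (\<phi> * \<theta> * real m powr (1/q) / \<Lambda>)"
    using \<phi> \<theta> \<Lambda> by (intro mult_left_mono divide_right_mono mult_right_mono) (auto simp: power2_eq_square mult_le_cancel_left1)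
  ultimately show "1/34560 * (\<phi> * \<theta>\<^sup>2 * real m powr (1/q) / ln (real n + 1)) \<le>
      K\<^sup>2 * cotype_const (tensor_space (3 * n)) p q *
      (p (\<Sum>i=1..3*n. \<Sum>j=1..3*n. \<Sum>k=1..3*n. e3 i j k) / p (\<Sum>i=1..3*n. e3 i i i))"
    unfolding \<Lambda>_def J_def D_def T.P_def tensor_of_diag tensor_of_ones by (simp add: mult_ac)
qed

end
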